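(* There exists a (von Neumann) regular ring $R$ such that $\operatorname{Dim}\mathcal{L}(R_R)\not\cong V(R)$.
   Context: Rings are associative and unital, not necessarily commutative. For a regular ring $R$, $\mathcal{L}(R_R)$ is the complemented modular lattice of all principal (equivalently, finitely generated) right ideals of $R$. $V(R)$ is the commutative monoid of isomorphism classes $[A]$ of finitely generated projective right $R$-modules, with $[A]+[B]=[A\oplus B]$. For a lattice $L$, the dimension monoid $\operatorname{Dim}L$ is the commutative monoid defined by generators $\Delta(a,b)$ (for $a\leq b$ in $L$) and the relations: (D0) $\Delta(a,a)=0$; (D1) $\Delta(a,c)=\Delta(a,b)+\Delta(b,c)$ for $a\leq b\leq c$; (D2) $\Delta(a,a\vee b)=\Delta(a\wedge b,b)$ for all $a,b\in L$. Here $\not\cong$ means that the two commutative monoids are not isomorphic. *)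

theory Defs
  imports "HOL-Algebra.Module" "HOL-Algebra.Lattice" "HOL-Library.Multiset"
begin

section \<open>Regular rings and their lattice of principal right ideals\<close>

text \<open>
  Rings are records with a carrier set inside a type. An existential claim about rings must
  fix that type; \<open>nat set set\<close> serves below only as a large set of names, and every
  ring of cardinality at most that of \<open>nat set set\<close> has an isomorphic copy there.
\<close>

locale regular_ring = ring +
  assumes regular: "x \<in> carrier R \<Longrightarrow> \<exists>y\<in>carrier R. x \<otimes> y \<otimes> x = x"

definition principal_right_ideal :: "('a, 'm) ring_scheme \<Rightarrow> 'a \<Rightarrow> 'a set" where
  "principal_right_ideal R x = {x \<otimes>\<^bsub>R\<^esub> r | r. r \<in> carrier R}"

definition right_ideal_lattice :: "('a, 'm) ring_scheme \<Rightarrow> 'a set gorder" where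
  "right_ideal_lattice R =
     \<lparr>carrier = principal_right_ideal R ` carrier R, eq = (=), le = (\<subseteq>)\<rparr>"


section \<open>The dimension monoid of a lattice\<close>

definition intervals :: "('a, 'm) gorder_scheme \<Rightarrow> ('a \<times> 'a) set" where
  "intervals L = {(a, b). a \<in> carrier L \<and> b \<in> carrier L \<and> a \<sqsubseteq>\<^bsub>L\<^esub> b}"

text \<open>
  The free commutative monoid on the symbols \<open>\<Delta>(a, b)\<close> consists of the finite multisets
  of intervals; the relation below is the congruence on it generated by (D0)--(D2).
\<close>

inductive dim_cong ::
    "('a, 'm) gorder_scheme \<Rightarrow> ('a \<times> 'a) multiset \<Rightarrow> ('a \<times> 'a) multiset \<Rightarrow> bool"
  for L (structure) where
  D0: "a \<in> carrier L \<Longrightarrow> dim_cong L {#(a, a)#} {#}"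
| D1: "\<lbrakk>a \<in> carrier L; b \<in> carrier L; c \<in> carrier L; a \<sqsubseteq> b; b \<sqsubseteq> c\<rbrakk> \<Longrightarrow>
         dim_cong L {#(a, c)#} {#(a, b), (b, c)#}"
| D2: "\<lbrakk>a \<in> carrier L; b \<in> carrier L\<rbrakk> \<Longrightarrow>
         dim_cong L {#(a, a \<squnion> b)#} {#(a \<sqinter> b, b)#}"
| refl: "set_mset X \<subseteq> intervals L \<Longrightarrow> dim_cong L X X"
| sym: "dim_cong L X Y \<Longrightarrow> dim_cong L Y X"
| trans: "\<lbrakk>dim_cong L X Y; dim_cong L Y Z\<rbrakk> \<Longrightarrow> dim_cong L X Z"
| add: "\<lbrakk>dim_cong L X Y; dim_cong L X' Y'\<rbrakk> \<Longrightarrow> dim_cong L (X + X') (Y + Y')"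

definition dim_class ::
    "('a, 'm) gorder_scheme \<Rightarrow> ('a \<times> 'a) multiset \<Rightarrow> ('a \<times> 'a) multiset set" where
  "dim_class L X = {Y. dim_cong L X Y}"

definition Dim :: "('a, 'm) gorder_scheme \<Rightarrow> ('a \<times> 'a) multiset set monoid" where
  "Dim L =
     \<lparr>carrier = dim_class L ` {X. set_mset X \<subseteq> intervals L},
      monoid.mult = (\<lambda>p q. \<Union>X\<in>p. \<Union>Y\<in>q. dim_class L (X + Y)),
      one = dim_class L {#}\<rparr>"


section \<open>Right modules\<close>

text \<open>
  The library's modules are over commutative rings only. Its record type is reused for
  right modules, so that \<open>r \<odot>\<^bsub>M\<^esub> x\<close> stands for the right action \<open>x r\<close>.
  As in the library, the fields \<open>mult\<close> and \<open>one\<close> of a module carry no meaning.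
\<close>

locale right_module = R?: ring R + M?: abelian_group M
  for R :: "('a, 'm) ring_scheme" (structure) and M :: "('a, 'b) module" (structure) +
  assumes smult_closed: "\<lbrakk>r \<in> carrier R; x \<in> carrier M\<rbrakk> \<Longrightarrow> r \<odot>\<^bsub>M\<^esub> x \<in> carrier M"
    and smult_add_left: "\<lbrakk>r \<in> carrier R; s \<in> carrier R; x \<in> carrier M\<rbrakk> \<Longrightarrow>
      (r \<oplus> s) \<odot>\<^bsub>M\<^esub> x = r \<odot>\<^bsub>M\<^esub> x \<oplus>\<^bsub>M\<^esub> s \<odot>\<^bsub>M\<^esub> x"
    and smult_add_right: "\<lbrakk>r \<in> carrier R; x \<in> carrier M; y \<in> carrier M\<rbrakk> \<Longrightarrow>
      r \<odot>\<^bsub>M\<^esub> (x \<oplus>\<^bsub>M\<^esub> y) = r \<odot>\<^bsub>M\<^esub> x \<oplus>\<^bsub>M\<^esub> r \<odot>\<^bsub>M\<^esub> y"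
    and smult_assoc: "\<lbrakk>r \<in> carrier R; s \<in> carrier R; x \<in> carrier M\<rbrakk> \<Longrightarrow>
      (r \<otimes> s) \<odot>\<^bsub>M\<^esub> x = s \<odot>\<^bsub>M\<^esub> (r \<odot>\<^bsub>M\<^esub> x)"
    and smult_one: "x \<in> carrier M \<Longrightarrow> \<one> \<odot>\<^bsub>M\<^esub> x = x"

definition mod_hom ::
    "('a, 'm) ring_scheme \<Rightarrow> ('a, 'b) module \<Rightarrow> ('a, 'c) module \<Rightarrow> ('b \<Rightarrow> 'c) set" where
  "mod_hom R M N = {h. h \<in> carrier M \<rightarrow> carrier N \<and>
     (\<forall>x\<in>carrier M. \<forall>y\<in>carrier M. h (x \<oplus>\<^bsub>M\<^esub> y) = h x \<oplus>\<^bsub>N\<^esub> h y) \<and>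
     (\<forall>r\<in>carrier R. \<forall>x\<in>carrier M. h (r \<odot>\<^bsub>M\<^esub> x) = r \<odot>\<^bsub>N\<^esub> h x)}"

definition mod_iso ::
    "('a, 'm) ring_scheme \<Rightarrow> ('a, 'b) module \<Rightarrow> ('a, 'c) module \<Rightarrow> bool" where
  "mod_iso R M N \<longleftrightarrow> (\<exists>h\<in>mod_hom R M N. bij_betw h (carrier M) (carrier N))"

definition direct_sum :: "('a, 'b) module \<Rightarrow> ('a, 'c) module \<Rightarrow> ('a, 'b \<times> 'c) module" where
  "direct_sum M N =
     \<lparr>carrier = carrier M \<times> carrier N,
      monoid.mult = undefined, one = undefined,
      zero = (\<zero>\<^bsub>M\<^esub>, \<zero>\<^bsub>N\<^esub>),
      add = (\<lambda>(x, y) (x', y'). (x \<oplus>\<^bsub>M\<^esub> x', y \<oplus>\<^bsub>N\<^esub> y')),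
      smult = (\<lambda>r (x, y). (r \<odot>\<^bsub>M\<^esub> x, r \<odot>\<^bsub>N\<^esub> y))\<rparr>"

definition finitely_generated :: "('a, 'm) ring_scheme \<Rightarrow> ('a, 'b) module \<Rightarrow> bool" where
  "finitely_generated R M \<longleftrightarrow> (\<exists>S. finite S \<and> S \<subseteq> carrier M \<and>
     (\<forall>x\<in>carrier M. \<exists>c\<in>S \<rightarrow> carrier R. x = (\<Oplus>\<^bsub>M\<^esub>s\<in>S. c s \<odot>\<^bsub>M\<^esub> s)))"

text \<open>
  The lifting property cannot quantify over modules in all types; the test modules are
  those whose carrier is a set of sequences in \<open>R\<close>. For finitely generated \<open>P\<close>
  this is no restriction: the free modules \<open>R\<^sup>n\<close> and a copy of \<open>P\<close> live there, so a
  surjection from some \<open>R\<^sup>n\<close> onto \<open>P\<close> splits, which makes \<open>P\<close> projective outright.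
\<close>

definition projective :: "('a, 'm) ring_scheme \<Rightarrow> ('a, 'b) module \<Rightarrow> bool" where
  "projective R P \<longleftrightarrow> (\<forall>(M :: ('a, nat \<Rightarrow> 'a) module) (N :: ('a, nat \<Rightarrow> 'a) module) f g.
     right_module R M \<and> right_module R N \<and>
     f \<in> mod_hom R P N \<and> g \<in> mod_hom R M N \<and> g ` carrier M = carrier N \<longrightarrow>
     (\<exists>h\<in>mod_hom R P M. \<forall>x\<in>carrier P. g (h x) = f x))"

definition fg_projective :: "('a, 'm) ring_scheme \<Rightarrow> ('a, 'b) module \<Rightarrow> bool" where
  "fg_projective R P \<longleftrightarrow> right_module R P \<and> finitely_generated R P \<and> projective R P"


section \<open>The monoid of isomorphism classes of finitely generated projective modules\<close>

text \<open>
  Every finitely generated right \<open>R\<close>-module has an isomorphic copy whose carrier is a set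
  of sequences in \<open>R\<close> (send an element to a choice of coefficients with respect to the
  generators), so isomorphism classes are formed among these. The direct sum of two such
  modules lives on pairs of sequences; its class consists of its copies on sequences.
\<close>

definition iso_class ::
    "('a, 'm) ring_scheme \<Rightarrow> ('a, 'b) module \<Rightarrow> ('a, nat \<Rightarrow> 'a) module set" where
  "iso_class R A = {B. fg_projective R B \<and> mod_iso R A B}"

definition V_monoid :: "('a, 'm) ring_scheme \<Rightarrow> ('a, nat \<Rightarrow> 'a) module set monoid" where
  "V_monoid R =
     \<lparr>carrier = {iso_class R A | A :: ('a, nat \<Rightarrow> 'a) module. fg_projective R A},
      monoid.mult = (\<lambda>p q. \<Union>A\<in>p. \<Union>B\<in>q. iso_class R (direct_sum A B)),
      one = {Z. fg_projective R Z \<and> carrier Z = {\<zero>\<^bsub>Z\<^esub>}}\<rparr>"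

end

theory Submission
  imports Defs "HOL-Computational_Algebra.Formal_Laurent_Series" "HOL-Library.Z2"
begin

text \<open>
  The two monoids are told apart by cancellation. In \<open>V(R)\<close> an equation \<open>p + q = p\<close> with
  \<open>q \<noteq> 0\<close> holds as soon as \<open>R\<close> has elements with \<open>y x = 1 \<noteq> x y\<close>, because then
  \<open>R \<cong> R \<oplus> (1 - x y) R\<close> (lemma \<open>V_monoid_absorption\<close>). In \<open>Dim L\<close> no such equation holds
  if \<open>L\<close> carries real functions \<open>d\<^sub>0, d\<^sub>1, \<dots>\<close> such that, for given elements and all large \<open>n\<close>,
  \<open>d\<^sub>n\<close> satisfies the modular law and is strictly increasing: the assignment
  \<open>\<Delta>(a, b) \<mapsto> (d\<^sub>n b - d\<^sub>n a)\<^sub>n\<close> defines a homomorphism from \<open>Dim L\<close> to germs at infinity of real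
  sequences; these germs form a group, and every \<open>\<Delta>(a, b)\<close> with \<open>a < b\<close> has an eventually
  positive value (lemma \<open>Dim_not_iso\<close>).

  A ring with both properties is the ring of all linear operators on the power series space
  \<open>K[[t]]\<close> over a finite field \<open>K\<close> which on some \<open>t\<^sup>n K[[t]]\<close> act as multiplication by some
  Laurent series \<open>a\<close>. Multiplication by \<open>t\<close> has a left inverse there but no right inverse.
  The ring is an extension of the field of Laurent series by the operators with \<open>a = 0\<close>, which
  have finite rank; operators with \<open>a \<noteq> 0\<close> have finite-dimensional kernel and cokernel. So every
  range is finite, or contains some \<open>t\<^sup>m K[[t]]\<close>, and linear algebra yields regularity
  (lemma \<open>laurent_op_regular\<close>). Sending \<open>x R\<close> to the range of \<open>x\<close> identifies the lattice of
  principal right ideals with the lattice of all subspaces of these two kinds. For such a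
  subspace \<open>W\<close> let \<open>d\<^sub>n W\<close> be the dimension of the image of \<open>W\<close> in \<open>K[[t]] / t\<^sup>n K[[t]]\<close>. It is
  eventually \<open>dim W\<close> for finite \<open>W\<close> and eventually \<open>n - codim W\<close> otherwise, so that both kinds
  of subspaces are measured on one scale, on which a subspace of finite codimension is strictly
  smaller than the whole space even when it is the range of an injective operator.
\<close>

section \<open>A cancellation criterion for dimension monoids\<close>

text \<open>
  Relation (D1) preserves the sums by telescoping, for every \<open>n\<close>; relation (D2) preserves them for
  those \<open>n\<close> at which the modular law holds for the two elements involved. A derivation of a
  congruence uses finitely many instances, so one bound on \<open>n\<close> serves for all of them.
\<close>

lemma dim_cong_eventually_sum_eq:
  fixes L (structure) and d :: "nat \<Rightarrow> 'a \<Rightarrow> real"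
  assumes modular: "\<And>a b. \<lbrakk>a \<in> carrier L; b \<in> carrier L\<rbrakk> \<Longrightarrow>
      \<forall>\<^sub>F n in sequentially. d n (a \<squnion> b) + d n (a \<sqinter> b) = d n a + d n b"
    and "dim_cong L X Y"
  shows "\<forall>\<^sub>F n in sequentially.
    (\<Sum>(a, b)\<in>#X. d n b - d n a) = (\<Sum>(a, b)\<in>#Y. d n b - d n a)"
  using assms(2)
proof induction
  case (D2 a b)
  then show ?case using modular[of a b] by (auto elim!: eventually_mono)
next
  case (trans X Y Z)
  from trans.IH show ?case by eventually_elim simp
next
  case (add X Y X' Y')
  from add.IH show ?case by eventually_elim simp
qed (auto elim: eventually_mono)

lemma dim_cong_trivial:
  assumes "\<And>a b. (a, b) \<in># Y \<Longrightarrow> a \<in> carrier L \<and> a = b"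
  shows "dim_cong L Y {#}"
  using assms
proof (induction Y)
  case empty
  then show ?case by (simp add: dim_cong.refl)
next
  case (add p Y)
  have "fst p \<in> carrier L" "p = (fst p, fst p)"
    using add.prems[of "fst p" "snd p"] by (auto simp: prod_eq_iff)
  then have "dim_cong L {#p#} {#}" using dim_cong.D0 by metis
  moreover have "dim_cong L Y {#}" by (rule add.IH[OF add.prems]) simp
  ultimately have "dim_cong L ({#p#} + Y) ({#} + {#})" by (rule dim_cong.add)
  then show ?case by simp
qed

text \<open>
  The sum over \<open>X\<close> cancels, so the sum over \<open>Y\<close> is eventually zero. Its terms are eventually
  nonnegative, and a term with \<open>a \<noteq> b\<close> is eventually positive, so \<open>Y\<close> contains only symbols
  \<open>\<Delta>(a, a)\<close>.
\<close>

lemma dim_cong_absorb: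
  fixes L (structure) and d :: "nat \<Rightarrow> 'a \<Rightarrow> real"
  assumes modular: "\<And>a b. \<lbrakk>a \<in> carrier L; b \<in> carrier L\<rbrakk> \<Longrightarrow>
      \<forall>\<^sub>F n in sequentially. d n (a \<squnion> b) + d n (a \<sqinter> b) = d n a + d n b"
    and strict: "\<And>a b. \<lbrakk>(a, b) \<in> intervals L; a \<noteq> b\<rbrakk> \<Longrightarrow>
      \<forall>\<^sub>F n in sequentially. d n a < d n b"
    and Y: "set_mset Y \<subseteq> intervals L" and absorb: "dim_cong L X (X + Y)"
  shows "dim_cong L Y {#}"
proof (rule dim_cong_trivial, rule ccontr)
  fix a b assume ab: "(a, b) \<in># Y" and "\<not> (a \<in> carrier L \<and> a = b)"
  then have neq: "a \<noteq> b" using Y by (auto simp: intervals_def)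
  have "\<forall>\<^sub>F n in sequentially. \<forall>p\<in>set_mset Y. d n (fst p) \<le> d n (snd p)"
  proof (rule eventually_ball_finite)
    show "\<forall>p\<in>set_mset Y. \<forall>\<^sub>F n in sequentially. d n (fst p) \<le> d n (snd p)"
    proof
      fix p assume "p \<in># Y"
      then have "(fst p, snd p) \<in> intervals L" using Y by auto
      then show "\<forall>\<^sub>F n in sequentially. d n (fst p) \<le> d n (snd p)"
        using strict[of "fst p" "snd p"] by (cases "fst p = snd p") (auto elim: eventually_mono)
    qed
  qed simp
  moreover have "\<forall>\<^sub>F n in sequentially. d n a < d n b" using strict Y ab neq by blast
  moreover have "\<forall>\<^sub>F n in sequentially. (\<Sum>(a, b)\<in>#Y. d n b - d n a) = 0"
    using dim_cong_eventually_sum_eq[where d = d, OF modular absorb] by (auto elim: eventually_mono)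
  ultimately have "\<forall>\<^sub>F n in sequentially. False"
  proof eventually_elim
    case (elim n)
    obtain Y' where Y': "Y = add_mset (a, b) Y'" using ab by (meson multi_member_split)
    have "0 \<le> (\<Sum>(a, b)\<in>#Y'. d n b - d n a)"
      using sum_mset_mono[of Y' "\<lambda>_. 0" "\<lambda>(a, b). d n b - d n a"] elim(1) Y' by fastforce
    then show False using elim Y' by simp
  qed
  then show False by simp
qed

lemma dim_class_eqI: "dim_cong L X Y \<Longrightarrow> dim_class L X = dim_class L Y"
  unfolding dim_class_def
  by (rule Collect_cong, rule iffI) (erule dim_cong.trans[OF dim_cong.sym], assumption, erule (1) dim_cong.trans)

lemma dim_class_mult:
  assumes "set_mset X \<subseteq> intervals L" and "set_mset Y \<subseteq> intervals L"
  shows "dim_class L X \<otimes>\<^bsub>Dim L\<^esub> dim_class L Y = dim_class L (X + Y)"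
proof -
  have *: "dim_class L (X' + Y') = dim_class L (X + Y)"
    if "X' \<in> dim_class L X" "Y' \<in> dim_class L Y" for X' Y'
  proof -
    have "dim_cong L (X + Y) (X' + Y')" using that by (simp add: dim_class_def dim_cong.add)
    then show ?thesis by (rule dim_class_eqI[symmetric])
  qed
  have "X \<in> dim_class L X" "Y \<in> dim_class L Y"
    using assms by (simp_all add: dim_class_def dim_cong.refl)
  then have "(\<Union>X'\<in>dim_class L X. \<Union>Y'\<in>dim_class L Y. dim_class L (X' + Y')) = dim_class L (X + Y)"
    using * by fast
  then show ?thesis by (simp add: Dim_def)
qed

text \<open>
  An isomorphism would carry \<open>p + q = p\<close> back to \<open>Dim L\<close>, where it forces the preimage of \<open>q\<close> to be
  the neutral element; then \<open>q\<close> would be neutral in \<open>M\<close>, contrary to \<open>q + z \<noteq> z\<close>.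
\<close>

lemma Dim_not_iso:
  fixes L (structure) and d :: "nat \<Rightarrow> 'a \<Rightarrow> real" and M :: "('c, 'm) monoid_scheme"
  assumes modular: "\<And>a b. \<lbrakk>a \<in> carrier L; b \<in> carrier L\<rbrakk> \<Longrightarrow>
      \<forall>\<^sub>F n in sequentially. d n (a \<squnion> b) + d n (a \<sqinter> b) = d n a + d n b"
    and strict: "\<And>a b. \<lbrakk>(a, b) \<in> intervals L; a \<noteq> b\<rbrakk> \<Longrightarrow>
      \<forall>\<^sub>F n in sequentially. d n a < d n b"
    and M: "p \<in> carrier M" "q \<in> carrier M" "z \<in> carrier M"
    and pq: "p \<otimes>\<^bsub>M\<^esub> q = p" and qz: "q \<otimes>\<^bsub>M\<^esub> z \<noteq> z"
  shows "\<not> (Dim L \<cong> M)"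
proof
  assume "Dim L \<cong> M"
  then obtain h where h: "h \<in> hom (Dim L) M" "bij_betw h (carrier (Dim L)) (carrier M)"
    by (auto simp: is_iso_def iso_def)
  have "\<exists>X. set_mset X \<subseteq> intervals L \<and> h (dim_class L X) = m" if "m \<in> carrier M" for m
  proof -
    have "m \<in> h ` carrier (Dim L)" using h(2) that by (simp add: bij_betw_def)
    then show ?thesis by (auto simp: Dim_def)
  qed
  with M obtain X Y Z where XYZ: "set_mset X \<subseteq> intervals L" "h (dim_class L X) = p"
    "set_mset Y \<subseteq> intervals L" "h (dim_class L Y) = q"
    "set_mset Z \<subseteq> intervals L" "h (dim_class L Z) = z" by metis
  have in_Dim: "dim_class L U \<in> carrier (Dim L)" if "set_mset U \<subseteq> intervals L" for U
    using that by (auto simp: Dim_def)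
  have h_add: "h (dim_class L (U + W)) = h (dim_class L U) \<otimes>\<^bsub>M\<^esub> h (dim_class L W)"
    if "set_mset U \<subseteq> intervals L" "set_mset W \<subseteq> intervals L" for U W
    using h(1) in_Dim that by (simp add: dim_class_mult[symmetric] hom_def)
  have "h (dim_class L (X + Y)) = h (dim_class L X)" using XYZ h_add pq by simp
  then have "dim_class L (X + Y) = dim_class L X"
    using h(2) XYZ(1,3) in_Dim by (auto simp: bij_betw_def dest: inj_onD)
  then have "dim_cong L X (X + Y)"
    using XYZ(1,3) dim_cong.refl[of "X + Y" L] by (auto simp: dim_class_def)
  from dim_cong_absorb[where d = d, OF modular strict XYZ(3) this] have "dim_cong L Y {#}" .
  then have "dim_cong L (Y + Z) ({#} + Z)"
    using XYZ(5) by (rule dim_cong.add[OF _ dim_cong.refl])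
  then have "dim_class L (Y + Z) = dim_class L Z" by (simp add: dim_class_eqI)
  then show False using XYZ h_add qz by metis
qed

section \<open>Absorption in the monoid of finitely generated projective modules\<close>

text \<open>
  The right ideal \<open>e R\<close> as a module, realised on constant sequences because the classes that make up
  \<open>V(R)\<close> consist of modules of sequences.
\<close>

definition principal_module :: "('a, 'm) ring_scheme \<Rightarrow> 'a \<Rightarrow> ('a, nat \<Rightarrow> 'a) module" where
  "principal_module R e =
     \<lparr>carrier = (\<lambda>x _. x) ` principal_right_ideal R e,
      monoid.mult = undefined, one = undefined,
      zero = (\<lambda>_. \<zero>\<^bsub>R\<^esub>),
      add = (\<lambda>f g n. f n \<oplus>\<^bsub>R\<^esub> g n),
      module.smult = (\<lambda>r f n. f n \<otimes>\<^bsub>R\<^esub> r)\<rparr>"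

context ring
begin

lemma principal_module_carrier_iff:
  "f \<in> carrier (principal_module R e) \<longleftrightarrow> (\<exists>r\<in>carrier R. f = (\<lambda>_. e \<otimes> r))"
  by (auto simp: principal_module_def principal_right_ideal_def)

lemma principal_module_right_module:
  assumes e: "e \<in> carrier R"
  shows "right_module R (principal_module R e)"
proof -
  let ?M = "principal_module R e"
  have "abelian_group ?M"
  proof (rule abelian_groupI)
    fix f g assume "f \<in> carrier ?M" "g \<in> carrier ?M"
    then obtain r s where "r \<in> carrier R" "s \<in> carrier R"
      "f = (\<lambda>_. e \<otimes> r)" "g = (\<lambda>_. e \<otimes> s)" by (auto simp: principal_module_carrier_iff)
    then show "f \<oplus>\<^bsub>?M\<^esub> g \<in> carrier ?M"
      unfolding principal_module_carrier_iff using e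
      by (intro bexI[of _ "r \<oplus> s"]) (auto simp: principal_module_def r_distr)
  next
    have "(\<lambda>_. \<zero>) = (\<lambda>_::nat. e \<otimes> \<zero>)" using e by simp
    then show "\<zero>\<^bsub>?M\<^esub> \<in> carrier ?M"
      unfolding principal_module_carrier_iff by (auto simp: principal_module_def)
  next
    fix f assume "f \<in> carrier ?M"
    then obtain r where "r \<in> carrier R" "f = (\<lambda>_. e \<otimes> r)"
      by (auto simp: principal_module_carrier_iff)
    then show "\<exists>g\<in>carrier ?M. g \<oplus>\<^bsub>?M\<^esub> f = \<zero>\<^bsub>?M\<^esub>"
      using e by (intro bexI[of _ "\<lambda>_. e \<otimes> (\<ominus> r)"])
        (auto simp: principal_module_carrier_iff, auto simp: principal_module_def r_minus l_neg)
  qed (use e in \<open>auto simp: principal_module_carrier_iff\<close>,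
      use e in \<open>auto simp: principal_module_def a_ac\<close>)
  then show ?thesis
  proof (rule right_module.intro[OF ring_axioms], unfold_locales)
    fix r f assume "r \<in> carrier R" "f \<in> carrier ?M"
    then show "r \<odot>\<^bsub>?M\<^esub> f \<in> carrier ?M"
      unfolding principal_module_carrier_iff using e
      by (auto simp: principal_module_def m_assoc intro!: bexI[of _ "_ \<otimes> r"])
  qed (use e in \<open>auto simp: principal_module_carrier_iff\<close>,
      use e in \<open>auto simp: principal_module_def m_assoc l_distr r_distr\<close>)
qed

text \<open>
  The module \<open>e R\<close> is generated by \<open>e\<close>. To lift \<open>f\<close> along \<open>g\<close>, choose a preimage \<open>m\<close> of \<open>f e\<close> and send
  \<open>x\<close> to \<open>m x\<close>; this lifts \<open>f\<close> because \<open>x = e x\<close> on \<open>e R\<close>.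
\<close>

lemma principal_module_fg_projective:
  assumes e: "e \<in> carrier R" and idem: "e \<otimes> e = e"
  shows "fg_projective R (principal_module R e)"
proof -
  let ?M = "principal_module R e" and ?g = "\<lambda>_::nat. e"
  interpret M: right_module R ?M using e by (rule principal_module_right_module)
  have gen: "?g \<in> carrier ?M"
    using e by (auto simp: principal_module_carrier_iff intro!: bexI[of _ \<one>])
  have "finitely_generated R ?M"
    unfolding finitely_generated_def
  proof (intro exI[of _ "{?g}"] conjI ballI)
    fix f assume "f \<in> carrier ?M"
    then obtain r where r: "r \<in> carrier R" "f = (\<lambda>_. e \<otimes> r)"
      by (auto simp: principal_module_carrier_iff)
    then have "f = (\<Oplus>\<^bsub>?M\<^esub>s\<in>{?g}. r \<odot>\<^bsub>?M\<^esub> s)"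
      using gen M.smult_closed[OF r(1) gen] by (simp add: M.M.finsum_insert) (simp add: principal_module_def)
    then show "\<exists>c\<in>{?g} \<rightarrow> carrier R. f = (\<Oplus>\<^bsub>?M\<^esub>s\<in>{?g}. c s \<odot>\<^bsub>?M\<^esub> s)"
      using r by (intro bexI[of _ "\<lambda>_. r"]) auto
  qed (use gen in auto)
  moreover have "projective R ?M"
    unfolding projective_def
  proof (intro allI impI)
    fix N P :: "('a, nat \<Rightarrow> 'a) module" and f g
    assume asm: "right_module R N \<and> right_module R P \<and>
      f \<in> mod_hom R ?M P \<and> g \<in> mod_hom R N P \<and> g ` carrier N = carrier P"
    then interpret N: right_module R N by simp
    have f: "\<And>r x. \<lbrakk>r \<in> carrier R; x \<in> carrier ?M\<rbrakk> \<Longrightarrow> f (r \<odot>\<^bsub>?M\<^esub> x) = r \<odot>\<^bsub>P\<^esub> f x"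
      and f_closed: "\<And>x. x \<in> carrier ?M \<Longrightarrow> f x \<in> carrier P"
      and g: "\<And>r x. \<lbrakk>r \<in> carrier R; x \<in> carrier N\<rbrakk> \<Longrightarrow> g (r \<odot>\<^bsub>N\<^esub> x) = r \<odot>\<^bsub>P\<^esub> g x"
      using asm by (auto simp: mod_hom_def)
    obtain m where m: "m \<in> carrier N" "g m = f ?g"
    proof -
      have "f ?g \<in> g ` carrier N" using asm f_closed[OF gen] by simp
      then show thesis using that by auto
    qed
    let ?h = "\<lambda>x. x 0 \<odot>\<^bsub>N\<^esub> m"
    have in_R: "x 0 \<in> carrier R" if "x \<in> carrier ?M" for x
      using that e by (auto simp: principal_module_carrier_iff)
    have "(x \<oplus>\<^bsub>?M\<^esub> y) 0 = x 0 \<oplus> y 0" "(r \<odot>\<^bsub>?M\<^esub> x) 0 = x 0 \<otimes> r" for x y r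
      by (simp_all add: principal_module_def)
    then have "?h \<in> mod_hom R ?M N"
      using in_R m(1) by (auto simp: mod_hom_def N.smult_closed N.smult_add_left N.smult_assoc)
    moreover have "g (?h x) = f x" if x: "x \<in> carrier ?M" for x
    proof -
      obtain r where r: "r \<in> carrier R" "x = (\<lambda>_. e \<otimes> r)"
        using x by (auto simp: principal_module_carrier_iff)
      have "x 0 \<odot>\<^bsub>?M\<^esub> ?g = x"
        using e r idem by (simp add: principal_module_def m_assoc[symmetric])
      then show ?thesis using g[OF in_R[OF x] m(1)] f[OF in_R[OF x] gen] m(2) by simp
    qed
    then have "\<forall>x\<in>carrier ?M. g (?h x) = f x" by (rule ballI)
    ultimately show "\<exists>h\<in>mod_hom R ?M N. \<forall>x\<in>carrier ?M. g (h x) = f x" by (intro bexI[of _ ?h])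
  qed
  ultimately show ?thesis by (simp add: fg_projective_def M.right_module_axioms)
qed

end

lemma mod_iso_refl: "mod_iso R M M"
  unfolding mod_iso_def by (rule bexI[of _ id]) (auto simp: mod_hom_def)

lemma mod_iso_trans:
  assumes "mod_iso R M N" and "mod_iso R N P"
  shows "mod_iso R M P"
proof -
  obtain f g where "f \<in> mod_hom R M N" "bij_betw f (carrier M) (carrier N)"
    "g \<in> mod_hom R N P" "bij_betw g (carrier N) (carrier P)"
    using assms by (auto simp: mod_iso_def)
  then have "g \<circ> f \<in> mod_hom R M P" "bij_betw (g \<circ> f) (carrier M) (carrier P)"
    by (auto simp: mod_hom_def Pi_iff intro: bij_betw_trans)
  then show ?thesis by (auto simp: mod_iso_def)
qed

lemma mod_iso_sym:
  assumes M: "right_module R M" and iso: "mod_iso R M N"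
  shows "mod_iso R N M"
proof -
  interpret M: right_module R M by fact
  obtain f where f: "f \<in> mod_hom R M N" and bij: "bij_betw f (carrier M) (carrier N)"
    using iso by (auto simp: mod_iso_def)
  define g where "g = inv_into (carrier M) f"
  have bij_g: "bij_betw g (carrier N) (carrier M)"
    unfolding g_def using bij by (rule bij_betw_inv_into)
  have g: "g (f x) = x" if "x \<in> carrier M" for x
    using bij that by (simp add: g_def bij_betw_inv_into_left)
  have onto: "\<exists>x\<in>carrier M. y = f x" if "y \<in> carrier N" for y
    using bij that by (auto simp: bij_betw_def)
  have "g \<in> mod_hom R N M"
    unfolding mod_hom_def
  proof (intro CollectI conjI ballI)
    show "g \<in> carrier N \<rightarrow> carrier M" using bij_g by (auto simp: bij_betw_def)
  next
    fix u v assume "u \<in> carrier N" "v \<in> carrier N"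
    then obtain x y where xy: "x \<in> carrier M" "y \<in> carrier M" "u = f x" "v = f y"
      using onto by meson
    then have "u \<oplus>\<^bsub>N\<^esub> v = f (x \<oplus>\<^bsub>M\<^esub> y)" using f by (simp add: mod_hom_def)
    then show "g (u \<oplus>\<^bsub>N\<^esub> v) = g u \<oplus>\<^bsub>M\<^esub> g v" using xy by (simp add: g)
  next
    fix r u assume "r \<in> carrier R" "u \<in> carrier N"
    then obtain x where x: "r \<in> carrier R" "x \<in> carrier M" "u = f x" using onto by meson
    then have "r \<odot>\<^bsub>N\<^esub> u = f (r \<odot>\<^bsub>M\<^esub> x)" using f by (simp add: mod_hom_def)
    then show "g (r \<odot>\<^bsub>N\<^esub> u) = r \<odot>\<^bsub>M\<^esub> g u" using x by (simp add: g M.smult_closed)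
  qed
  then show ?thesis using bij_g by (auto simp: mod_iso_def)
qed

lemma right_module_direct_sum:
  assumes "right_module R A" and "right_module R B"
  shows "right_module R (direct_sum A B)"
proof -
  interpret A: right_module R A by fact
  interpret B: right_module R B by fact
  have "abelian_group (direct_sum A B)"
  proof (rule abelian_groupI)
    fix p assume "p \<in> carrier (direct_sum A B)"
    then show "\<exists>q\<in>carrier (direct_sum A B). q \<oplus>\<^bsub>direct_sum A B\<^esub> p = \<zero>\<^bsub>direct_sum A B\<^esub>"
      by (intro bexI[of _ "(\<ominus>\<^bsub>A\<^esub> fst p, \<ominus>\<^bsub>B\<^esub> snd p)"])
        (auto simp: direct_sum_def A.M.l_neg B.M.l_neg)
  qed (auto simp: direct_sum_def A.M.a_ac B.M.a_ac)
  then show ?thesis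
    by (rule right_module.intro[OF A.R.ring_axioms], unfold_locales)
      (auto simp: direct_sum_def A.smult_closed B.smult_closed A.smult_add_left B.smult_add_left
        A.smult_add_right B.smult_add_right A.smult_assoc B.smult_assoc A.smult_one B.smult_one)
qed

lemma mod_iso_direct_sum:
  assumes "mod_iso R A A'" and "mod_iso R B B'"
  shows "mod_iso R (direct_sum A B) (direct_sum A' B')"
proof -
  obtain f g where fg: "f \<in> mod_hom R A A'" "bij_betw f (carrier A) (carrier A')"
    "g \<in> mod_hom R B B'" "bij_betw g (carrier B) (carrier B')"
    using assms by (auto simp: mod_iso_def)
  then have "map_prod f g \<in> mod_hom R (direct_sum A B) (direct_sum A' B')"
    by (auto simp: mod_hom_def direct_sum_def)
  moreover have "bij_betw (map_prod f g) (carrier (direct_sum A B)) (carrier (direct_sum A' B'))"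
    using fg by (simp add: direct_sum_def bij_betw_map_prod)
  ultimately show ?thesis by (auto simp: mod_iso_def)
qed

context ring
begin

lemma complement_of_one_sided_inverse:
  assumes xy: "x \<in> carrier R" "y \<in> carrier R" "y \<otimes> x = \<one>"
  defines "e \<equiv> \<one> \<ominus> x \<otimes> y"
  shows "e \<in> carrier R" and "y \<otimes> e = \<zero>" and "e \<otimes> x = \<zero>" and "e \<otimes> e = e"
    and "x \<otimes> y \<oplus> e = \<one>"
proof -
  show e: "e \<in> carrier R" using xy by (simp add: e_def)
  have "y \<otimes> (x \<otimes> y) = y" using xy by (simp add: m_assoc[symmetric])
  then show ye: "y \<otimes> e = \<zero>" using xy by (simp add: e_def minus_eq r_distr r_minus r_neg)
  show "e \<otimes> x = \<zero>" using xy by (simp add: e_def minus_eq l_distr l_minus r_neg m_assoc)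
  have "e \<otimes> e = e \<ominus> x \<otimes> (y \<otimes> e)"
    using xy e unfolding e_def by (simp add: minus_eq l_distr l_minus m_assoc)
  then show "e \<otimes> e = e" using ye xy e by (simp add: minus_eq)
  show "x \<otimes> y \<oplus> e = \<one>" using xy by (simp add: e_def minus_eq a_lcomm[of "x \<otimes> y"] r_neg)
qed

text \<open>
  Left multiplication by \<open>x\<close> maps \<open>R\<close> isomorphically onto \<open>x R\<close>, which is complemented in \<open>R\<close> by
  \<open>(1 - x y) R\<close>. The isomorphism is \<open>(a, s) \<mapsto> x a + s\<close>, with inverse
  \<open>a \<mapsto> (y a, (1 - x y) a)\<close>.
\<close>

lemma mod_iso_principal_split:
  assumes xy: "x \<in> carrier R" "y \<in> carrier R" "y \<otimes> x = \<one>"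
  shows "mod_iso R (direct_sum (principal_module R \<one>) (principal_module R (\<one> \<ominus> x \<otimes> y)))
           (principal_module R \<one>)"
proof -
  define e where "e = \<one> \<ominus> x \<otimes> y"
  note e = complement_of_one_sided_inverse[OF xy, folded e_def]
  let ?P = "principal_module R \<one>" and ?S = "principal_module R e"
  let ?D = "direct_sum ?P ?S"
  define h where "h = (\<lambda>(f, g) n::nat. x \<otimes> f n \<oplus> g n)"
  have P: "f \<in> carrier ?P \<longleftrightarrow> (\<exists>a\<in>carrier R. f = (\<lambda>_. a))" for f
    by (auto simp: principal_module_carrier_iff)
  have D: "\<exists>a\<in>carrier R. \<exists>r\<in>carrier R. p = ((\<lambda>_. a), (\<lambda>_. e \<otimes> r)) \<and> h p = (\<lambda>_. x \<otimes> a \<oplus> e \<otimes> r)"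
    if "p \<in> carrier ?D" for p
    using that by (cases p) (auto simp: direct_sum_def P principal_module_carrier_iff h_def)
  have in_P: "h p \<in> carrier ?P" if p: "p \<in> carrier ?D" for p
  proof -
    obtain a r where "a \<in> carrier R" "r \<in> carrier R" "h p = (\<lambda>_. x \<otimes> a \<oplus> e \<otimes> r)"
      using D[OF p] by auto
    then show ?thesis unfolding P using xy e by (intro bexI[of _ "x \<otimes> a \<oplus> e \<otimes> r"]) simp_all
  qed
  have "h \<in> mod_hom R ?D ?P"
    unfolding mod_hom_def
  proof (intro CollectI conjI ballI)
    show "h \<in> carrier ?D \<rightarrow> carrier ?P" using in_P by simp
  next
    fix p q assume "p \<in> carrier ?D" "q \<in> carrier ?D"
    then obtain a r b s where *: "a \<in> carrier R" "r \<in> carrier R" "b \<in> carrier R" "s \<in> carrier R"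
      "p = ((\<lambda>_. a), (\<lambda>_. e \<otimes> r))" "q = ((\<lambda>_. b), (\<lambda>_. e \<otimes> s))" using D by metis
    have "x \<otimes> (a \<oplus> b) \<oplus> (e \<otimes> r \<oplus> e \<otimes> s) = x \<otimes> a \<oplus> e \<otimes> r \<oplus> (x \<otimes> b \<oplus> e \<otimes> s)"
      using *(1-4) xy(1) e(1) by (simp add: r_distr a_ac)
    then show "h (p \<oplus>\<^bsub>?D\<^esub> q) = h p \<oplus>\<^bsub>?P\<^esub> h q"
      using * by (simp add: direct_sum_def principal_module_def h_def)
  next
    fix r p assume "p \<in> carrier ?D" and r: "r \<in> carrier R"
    then obtain a s where *: "a \<in> carrier R" "s \<in> carrier R" "p = ((\<lambda>_. a), (\<lambda>_. e \<otimes> s))"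
      using D by metis
    have "x \<otimes> (a \<otimes> r) \<oplus> (e \<otimes> s) \<otimes> r = (x \<otimes> a \<oplus> e \<otimes> s) \<otimes> r"
      using *(1,2) r xy(1) e(1) by (simp add: l_distr m_assoc)
    then show "h (r \<odot>\<^bsub>?D\<^esub> p) = r \<odot>\<^bsub>?P\<^esub> h p"
      using * by (simp add: direct_sum_def principal_module_def h_def)
  qed
  moreover have "bij_betw h (carrier ?D) (carrier ?P)"
  proof (rule bij_betw_byWitness[where f' = "\<lambda>f. ((\<lambda>n. y \<otimes> f n), (\<lambda>n. e \<otimes> f n))"])
    show "\<forall>p\<in>carrier ?D. ((\<lambda>n. y \<otimes> h p n), (\<lambda>n. e \<otimes> h p n)) = p"
    proof
      fix p assume "p \<in> carrier ?D"
      then obtain a r where ar: "a \<in> carrier R" "r \<in> carrier R"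
        "p = ((\<lambda>_. a), (\<lambda>_. e \<otimes> r))" "h p = (\<lambda>_. x \<otimes> a \<oplus> e \<otimes> r)" using D by metis
      have "y \<otimes> (x \<otimes> a \<oplus> e \<otimes> r) = (y \<otimes> x) \<otimes> a \<oplus> (y \<otimes> e) \<otimes> r"
        using ar(1,2) xy(1,2) e(1) by (simp add: r_distr m_assoc)
      then have "y \<otimes> (x \<otimes> a \<oplus> e \<otimes> r) = a" using ar xy e by simp
      moreover have "e \<otimes> (x \<otimes> a \<oplus> e \<otimes> r) = (e \<otimes> x) \<otimes> a \<oplus> (e \<otimes> e) \<otimes> r"
        using ar(1,2) xy(1) e(1) by (simp add: r_distr m_assoc)
      then have "e \<otimes> (x \<otimes> a \<oplus> e \<otimes> r) = e \<otimes> r" using ar xy e by simp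
      ultimately show "((\<lambda>n. y \<otimes> h p n), (\<lambda>n. e \<otimes> h p n)) = p" using ar by simp
    qed
    show "\<forall>f\<in>carrier ?P. h ((\<lambda>n. y \<otimes> f n), (\<lambda>n. e \<otimes> f n)) = f"
    proof
      fix f assume "f \<in> carrier ?P"
      then obtain a where a: "a \<in> carrier R" "f = (\<lambda>_. a)" using P by auto
      have "x \<otimes> (y \<otimes> a) \<oplus> e \<otimes> a = (x \<otimes> y \<oplus> e) \<otimes> a"
        using a(1) xy(1,2) e(1) by (simp add: l_distr m_assoc)
      then show "h ((\<lambda>n. y \<otimes> f n), (\<lambda>n. e \<otimes> f n)) = f" using a e by (simp add: h_def)
    qed
    show "h ` carrier ?D \<subseteq> carrier ?P" using in_P by auto
    show "(\<lambda>f. ((\<lambda>n. y \<otimes> f n), (\<lambda>n. e \<otimes> f n))) ` carrier ?P \<subseteq> carrier ?D"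
    proof
      fix p assume "p \<in> (\<lambda>f. ((\<lambda>n. y \<otimes> f n), (\<lambda>n. e \<otimes> f n))) ` carrier ?P"
      then obtain a where a: "a \<in> carrier R" "p = ((\<lambda>_. y \<otimes> a), (\<lambda>_. e \<otimes> a))"
        by (auto simp: P)
      then have "(\<lambda>_. y \<otimes> a) \<in> carrier ?P" unfolding P using xy by blast
      moreover have "(\<lambda>_. e \<otimes> a) \<in> carrier ?S" using a by (auto simp: principal_module_carrier_iff)
      ultimately show "p \<in> carrier ?D" using a by (simp add: direct_sum_def)
    qed
  qed
  ultimately show ?thesis by (auto simp: mod_iso_def e_def)
qed

text \<open>
  Take the classes \<open>p = [R]\<close>, \<open>q = [(1 - x y) R]\<close> and \<open>z = [0]\<close>. The class \<open>q\<close> is not neutral,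
  since \<open>q + z = z\<close> would make the nonzero module \<open>(1 - x y) R\<close> a singleton.
\<close>

lemma V_monoid_absorption:
  assumes xy: "x \<in> carrier R" "y \<in> carrier R" "y \<otimes> x = \<one>" "x \<otimes> y \<noteq> \<one>"
  obtains p q z where "p \<in> carrier (V_monoid R)" "q \<in> carrier (V_monoid R)"
    "z \<in> carrier (V_monoid R)" "p \<otimes>\<^bsub>V_monoid R\<^esub> q = p" "q \<otimes>\<^bsub>V_monoid R\<^esub> z \<noteq> z"
proof
  define e where "e = \<one> \<ominus> x \<otimes> y"
  note e = complement_of_one_sided_inverse[OF xy(1-3), folded e_def]
  note split = mod_iso_principal_split[OF xy(1-3), folded e_def]
  let ?P = "principal_module R \<one>" and ?S = "principal_module R e"
    and ?Z = "principal_module R \<zero>"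
  have P: "fg_projective R ?P" and S: "fg_projective R ?S" and Z: "fg_projective R ?Z"
    using e by (simp_all add: principal_module_fg_projective)
  then show "iso_class R ?P \<in> carrier (V_monoid R)" "iso_class R ?S \<in> carrier (V_monoid R)"
    "iso_class R ?Z \<in> carrier (V_monoid R)" by (auto simp: V_monoid_def)
  have sym: "mod_iso R B A" if "mod_iso R A B" "fg_projective R A" for A B :: "('a, nat \<Rightarrow> 'a) module"
    using that mod_iso_sym by (auto simp: fg_projective_def)
  have mem: "?P \<in> iso_class R ?P" "?S \<in> iso_class R ?S" "?Z \<in> iso_class R ?Z"
    using P S Z by (simp_all add: iso_class_def mod_iso_refl)
  have "iso_class R (direct_sum A B) = iso_class R ?P"
    if "A \<in> iso_class R ?P" "B \<in> iso_class R ?S" for A B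
  proof -
    have 1: "mod_iso R (direct_sum A B) ?P"
    proof (rule mod_iso_trans[OF mod_iso_direct_sum split])
      show "mod_iso R A ?P" "mod_iso R B ?S" using that P S by (simp_all add: iso_class_def sym)
    qed
    have 2: "mod_iso R ?P (direct_sum A B)"
    proof (rule mod_iso_trans[OF mod_iso_sym mod_iso_direct_sum])
      show "mod_iso R (direct_sum ?P ?S) ?P" by (rule split)
      show "right_module R (direct_sum ?P ?S)"
        using P S by (simp add: fg_projective_def right_module_direct_sum)
      show "mod_iso R ?P A" "mod_iso R ?S B" using that by (auto simp: iso_class_def)
    qed
    show ?thesis using 1 2 by (auto simp: iso_class_def intro: mod_iso_trans)
  qed
  then show "iso_class R ?P \<otimes>\<^bsub>V_monoid R\<^esub> iso_class R ?S = iso_class R ?P"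
    using mem by (simp add: V_monoid_def) blast
  show "iso_class R ?S \<otimes>\<^bsub>V_monoid R\<^esub> iso_class R ?Z \<noteq> iso_class R ?Z"
  proof
    assume "iso_class R ?S \<otimes>\<^bsub>V_monoid R\<^esub> iso_class R ?Z = iso_class R ?Z"
    then have "?Z \<in> iso_class R ?S \<otimes>\<^bsub>V_monoid R\<^esub> iso_class R ?Z" using mem by simp
    then obtain A B :: "('a, nat \<Rightarrow> 'a) module" where AB: "mod_iso R ?S A" "mod_iso R ?Z B" "mod_iso R (direct_sum A B) ?Z"
      by (auto simp: V_monoid_def iso_class_def)
    have "mod_iso R (direct_sum ?S ?Z) ?Z"
      using AB by (blast intro: mod_iso_trans mod_iso_direct_sum)
    then obtain h where h: "bij_betw h (carrier ?S \<times> carrier ?Z) (carrier ?Z)"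
      by (auto simp: mod_iso_def direct_sum_def)
    have Z: "carrier ?Z = {\<lambda>_. \<zero>}" by (auto simp: principal_module_carrier_iff intro!: exI[of _ \<zero>])
    have "e = e \<otimes> \<one>" "\<zero> = e \<otimes> \<zero>" using e(1) by simp_all
    then have S': "(\<lambda>_. e) \<in> carrier ?S" "(\<lambda>_. \<zero>) \<in> carrier ?S"
      unfolding principal_module_carrier_iff by (metis one_closed, metis zero_closed)
    have "inj_on h (carrier ?S \<times> carrier ?Z)" using h by (simp add: bij_betw_def)
    moreover have "h ((\<lambda>_. e), (\<lambda>_. \<zero>)) = h ((\<lambda>_. \<zero>), (\<lambda>_. \<zero>))"
      using bij_betwE[OF h] S' by (simp add: Z)
    ultimately have "((\<lambda>_::nat. e), (\<lambda>_::nat. \<zero>)) = ((\<lambda>_. \<zero>), (\<lambda>_. \<zero>))"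
      by (rule inj_onD) (use S' Z in simp_all)
    then have "e = \<zero>" by (simp add: fun_eq_iff)
    then show False using xy e(5) by simp
  qed
qed

end

section \<open>Linear operators and the t-adic filtration on power series\<close>

interpretation fps: vector_space "\<lambda>c v :: 'k::field fps. fps_const c * v"
  by unfold_locales (simp_all add: algebra_simps flip: fps_const_add fps_const_mult)

interpretation fps: vector_space_pair
    "\<lambda>c v :: 'k::field fps. fps_const c * v" "\<lambda>c v :: 'k::field fps. fps_const c * v"
  by unfold_locales

definition linear_op :: "('k::field fps \<Rightarrow> 'k fps) \<Rightarrow> bool" where
  "linear_op x \<longleftrightarrow> (\<forall>u v. x (u + v) = x u + x v) \<and> (\<forall>c v. x (fps_const c * v) = fps_const c * x v)"

lemma linear_op_linear:
  "linear_op x \<longleftrightarrow> Vector_Spaces.linear (\<lambda>c v. fps_const c * v) (\<lambda>c v. fps_const c * v) x"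
  by (simp add: linear_op_def Vector_Spaces.linear_iff fps.vector_space_axioms)

lemma linear_op_zero: "linear_op x \<Longrightarrow> x 0 = 0"
  unfolding linear_op_def by (metis add_cancel_right_right)

lemma linear_op_comp: "linear_op x \<Longrightarrow> linear_op y \<Longrightarrow> linear_op (x \<circ> y)"
  by (simp add: linear_op_def)

lemma linear_op_image_subspace: "linear_op x \<Longrightarrow> fps.subspace W \<Longrightarrow> fps.subspace (x ` W)"
  unfolding linear_op_linear by (rule fps.linear_subspace_image)

lemma linear_op_left_inverse:
  assumes "linear_op x" "fps.subspace W" "inj_on x W"
  obtains g where "linear_op g" "range g \<subseteq> W" "\<And>w. w \<in> W \<Longrightarrow> g (x w) = w"
proof -
  from fps.linear_exists_left_inverse_on[OF assms(1)[unfolded linear_op_linear] assms(2,3)]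
  obtain g where "range g \<subseteq> W" "linear_op g" "\<forall>w\<in>W. g (x w) = w"
    unfolding linear_op_linear by (elim exE conjE)
  then show thesis by (intro that[of g]) auto
qed

lemma linear_op_section:
  assumes "linear_op x"
  obtains g where "linear_op g" "\<And>v. v \<in> range x \<Longrightarrow> x (g v) = v"
proof -
  from fps.linear_exists_right_inverse_on[OF assms[unfolded linear_op_linear] fps.subspace_UNIV]
  obtain g where "linear_op g" "\<forall>v\<in>range x. x (g v) = v"
    unfolding linear_op_linear by (elim exE conjE)
  then show thesis by (intro that[of g]) auto
qed

lemma linear_op_cutoff: "linear_op (fps_cutoff n)"
  by (simp add: linear_op_def fps_cutoff_add fps_eq_iff)

text \<open>
  The subspace \<open>t\<^sup>n K[[t]]\<close>.
\<close>

definition tail :: "nat \<Rightarrow> 'k::field fps set" where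
  "tail n = {v. \<forall>i<n. v $ i = 0}"

lemma tail_subspace: "fps.subspace (tail n)"
  by (auto simp: fps.subspace_def tail_def)

lemma tail_antimono: "m \<le> n \<Longrightarrow> tail n \<subseteq> tail m"
  by (auto simp: tail_def)

lemma zero_in_tail [simp]: "0 \<in> tail n"
  by (simp add: tail_def)

lemma cutoff_eq_iff: "fps_cutoff n u = fps_cutoff n v \<longleftrightarrow> u - v \<in> tail n"
  for u v :: "'k::field fps"
  by (simp add: fps_cutoff_eq_fps_cutoff_iff tail_def)

lemma cutoff_zero_iff: "fps_cutoff n v = 0 \<longleftrightarrow> v \<in> tail n"
  for v :: "'k::field fps"
  using cutoff_eq_iff[of n v 0] by simp

lemma tail_iff_subdegree: "v \<in> tail n \<longleftrightarrow> v = 0 \<or> n \<le> subdegree v"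
  by (simp add: cutoff_zero_iff[symmetric] fps_cutoff_zero_iff)

text \<open>
  Multiplication by a Laurent series \<open>a\<close> moves the filtration by the subdegree of \<open>a\<close>.
\<close>

lemma laurent_times_tail:
  assumes v: "v \<in> tail m" and w: "fps_to_fls w = a * fps_to_fls v"
    and n: "int n \<le> int m + fls_subdegree a"
  shows "w \<in> tail n"
proof (cases "w = 0")
  case False
  then have "a \<noteq> 0" "v \<noteq> 0" using w by auto
  then have "fls_subdegree (fps_to_fls w) = fls_subdegree a + fls_subdegree (fps_to_fls v)"
    using w by simp
  then have "int (subdegree w) = fls_subdegree a + int (subdegree v)"
    by (simp add: fls_subdegree_fls_to_fps)
  then show ?thesis using v n \<open>v \<noteq> 0\<close> by (simp add: tail_iff_subdegree)
qed simp

lemma laurent_times_tail_exists: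
  assumes v: "v \<in> tail m" and m: "0 \<le> int m + fls_subdegree a"
  obtains w where "fps_to_fls w = a * fps_to_fls v"
proof
  have "0 \<le> fls_subdegree (a * fps_to_fls v)"
  proof (cases "a = 0 \<or> v = 0")
    case False
    then have "fls_subdegree (a * fps_to_fls v) = fls_subdegree a + int (subdegree v)"
      by (simp add: fls_subdegree_fls_to_fps)
    then show ?thesis using v m False by (simp add: tail_iff_subdegree)
  qed auto
  then show "fps_to_fls (fls_regpart (a * fps_to_fls v)) = a * fps_to_fls v" by simp
qed

lemma finite_range_cutoff: "finite (range (fps_cutoff n :: 'k::{field,finite} fps \<Rightarrow> _))"
proof -
  let ?F = "\<lambda>xs. Abs_fps (\<lambda>i. if i < n then xs ! i else 0) :: 'k fps"
  have "fps_cutoff n v = ?F (map (fps_nth v) [0..<n])" for v :: "'k fps"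
    by (simp add: fps_eq_iff)
  then have "fps_cutoff n v \<in> ?F ` {xs. set xs \<subseteq> UNIV \<and> length xs = n}" for v :: "'k fps"
    by (rule image_eqI) simp
  then have "range (fps_cutoff n) \<subseteq> ?F ` {xs. set xs \<subseteq> UNIV \<and> length xs = n}" by blast
  then show ?thesis
    by (rule finite_subset) (intro finite_imageI finite_lists_length_eq finite)
qed

text \<open>
  A finite set has only finitely many subdegrees, and a nonzero series lies in no tail beyond its
  subdegree.
\<close>

lemma finite_inter_tail:
  assumes "finite W"
  obtains m where "W \<inter> tail m \<subseteq> {0}"
proof
  show "W \<inter> tail (Suc (Max (subdegree ` W))) \<subseteq> {0}"
  proof
    fix w assume w: "w \<in> W \<inter> tail (Suc (Max (subdegree ` W)))"
    then have "subdegree w \<le> Max (subdegree ` W)" using assms by simp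
    with w show "w \<in> {0}" by (auto simp: tail_iff_subdegree)
  qed
qed

section \<open>Finite and open subspaces, and their truncated dimensions\<close>

text \<open>
  Over a finite field the finite subspaces are those of finite dimension; the subspaces that contain
  a tail are those that are open in the t-adic topology, and they have finite codimension. These two
  kinds turn out to be the ranges of the operators in the ring.
\<close>

definition tame :: "'k::field fps set \<Rightarrow> bool" where
  "tame W \<longleftrightarrow> fps.subspace W \<and> (finite W \<or> (\<exists>m. tail m \<subseteq> W))"

definition subspace_sum :: "'k::field fps set \<Rightarrow> 'k fps set \<Rightarrow> 'k fps set" where
  "subspace_sum A B = {a + b | a b. a \<in> A \<and> b \<in> B}"

lemma subspace_sum_image: "subspace_sum A B = (\<lambda>(a, b). a + b) ` (A \<times> B)"
  by (auto simp: subspace_sum_def)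

lemma tame_inter: "tame A \<Longrightarrow> tame B \<Longrightarrow> tame (A \<inter> B)"
proof -
  assume A: "tame A" and B: "tame B"
  have "\<exists>m. tail m \<subseteq> A \<inter> B" if "tail k \<subseteq> A" "tail l \<subseteq> B" for k l
    using that tail_antimono[of k "max k l"] tail_antimono[of l "max k l"] by (intro exI[of _ "max k l"]) auto
  then show "tame (A \<inter> B)"
    using A B by (auto simp: tame_def fps.subspace_inter)
qed

lemma subspace_subspace_sum:
  "fps.subspace A \<Longrightarrow> fps.subspace B \<Longrightarrow> fps.subspace (subspace_sum A B)"
  using fps.subspace_sums[of A B] by (simp add: subspace_sum_def)

lemma subset_subspace_sum:
  "fps.subspace A \<Longrightarrow> fps.subspace B \<Longrightarrow> A \<subseteq> subspace_sum A B \<and> B \<subseteq> subspace_sum A B"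
  by (force simp: subspace_sum_def dest: fps.subspace_0)

lemma tame_sum: "tame A \<Longrightarrow> tame B \<Longrightarrow> tame (subspace_sum A B)"
  unfolding tame_def
  using subset_subspace_sum[of A B] subspace_subspace_sum[of A B]
  by (metis finite_cartesian_product finite_imageI subset_trans subspace_sum_image)

text \<open>
  Tame subspaces are closed in the t-adic topology. For finite \<open>A\<close> the finitely many nonzero series
  \<open>b - a\<close> avoid a common tail; for open \<open>A\<close>, a difference \<open>b - a\<close> inside the tail contained in \<open>A\<close>
  would put \<open>b\<close> into \<open>A\<close>.
\<close>

lemma tame_closed:
  assumes A: "tame A" and b: "b \<notin> A"
  shows "\<forall>\<^sub>F n in sequentially. fps_cutoff n b \<notin> fps_cutoff n ` A"
proof -
  have sub: "fps.subspace A" using A by (simp add: tame_def)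
  obtain m where m: "\<And>a. a \<in> A \<Longrightarrow> b - a \<notin> tail m"
  proof (cases "finite A")
    case True
    then obtain m where m: "(\<lambda>a. b - a) ` A \<inter> tail m \<subseteq> {0}" by (meson finite_imageI finite_inter_tail)
    show ?thesis
    proof (rule that)
      fix a assume "a \<in> A"
      then show "b - a \<notin> tail m" using m b by auto
    qed
  next
    case False
    then obtain m where m: "tail m \<subseteq> A" using A by (auto simp: tame_def)
    show ?thesis
    proof (rule that)
      fix a assume "a \<in> A"
      then show "b - a \<notin> tail m" using m b fps.subspace_add[OF sub, of "b - a" a] by auto
    qed
  qed
  show ?thesis
  proof (rule eventually_sequentiallyI)
    fix n assume "m \<le> n"
    then show "fps_cutoff n b \<notin> fps_cutoff n ` A"
      using m tail_antimono[of m n] by (auto simp: cutoff_eq_iff)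
  qed
qed

text \<open>
  Truncation need not commute with intersections for a fixed \<open>n\<close>. It does so once \<open>n\<close> is large: if
  \<open>a\<close> and \<open>b\<close> have equal truncations, then \<open>a - b\<close> lies in a tail, so it is zero if \<open>A\<close> and \<open>B\<close> are
  finite, and lies in \<open>A\<close> or in \<open>B\<close> if one of them is open.
\<close>

lemma tame_cutoff_inter:
  assumes A: "tame A" and B: "tame B"
  shows "\<forall>\<^sub>F n in sequentially.
    fps_cutoff n ` A \<inter> fps_cutoff n ` B = fps_cutoff n ` (A \<inter> B)"
proof -
  have sA: "fps.subspace A" and sB: "fps.subspace B" using A B by (simp_all add: tame_def)
  have "\<exists>m. \<forall>a\<in>A. \<forall>b\<in>B. a - b \<in> tail m \<longrightarrow> a \<in> B \<or> b \<in> A"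
  proof (cases "finite A \<and> finite B")
    case True
    then have "finite ((\<lambda>(a, b). a - b) ` (A \<times> B))" by simp
    then obtain m where "(\<lambda>(a, b). a - b) ` (A \<times> B) \<inter> tail m \<subseteq> {0}" by (rule finite_inter_tail)
    then show ?thesis by (intro exI[of _ m]) force
  next
    case False
    then obtain m where "tail m \<subseteq> A \<or> tail m \<subseteq> B" using A B by (auto simp: tame_def)
    moreover have "b \<in> A" if "a \<in> A" "a - b \<in> A" for a b
      using fps.subspace_diff[OF sA that] by simp
    moreover have "a \<in> B" if "b \<in> B" "a - b \<in> B" for a b
      using fps.subspace_add[OF sB that] by simp
    ultimately show ?thesis by blast
  qed
  then obtain m where m: "\<And>a b. \<lbrakk>a \<in> A; b \<in> B; a - b \<in> tail m\<rbrakk> \<Longrightarrow> a \<in> B \<or> b \<in> A" by blast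
  show ?thesis
  proof (rule eventually_sequentiallyI)
    fix n assume n: "m \<le> n"
    have "fps_cutoff n a \<in> fps_cutoff n ` (A \<inter> B)"
      if "a \<in> A" "b \<in> B" "fps_cutoff n a = fps_cutoff n b" for a b
    proof -
      have "a - b \<in> tail m" using that(3) tail_antimono[OF n] by (auto simp: cutoff_eq_iff)
      from m[OF that(1,2) this] show ?thesis using that by (metis IntI imageI)
    qed
    then show "fps_cutoff n ` A \<inter> fps_cutoff n ` B = fps_cutoff n ` (A \<inter> B)" by fast
  qed
qed

text \<open>
  The addition map from \<open>A \<times> B\<close> onto \<open>A + B\<close> is a homomorphism, and its fibres are the cosets of the
  antidiagonal copy of \<open>A \<inter> B\<close>.
\<close>

lemma card_subspace_sum:
  assumes "finite A" "finite B" and A: "fps.subspace A" and B: "fps.subspace B"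
  shows "card (subspace_sum A B) * card (A \<inter> B) = card A * card B"
proof -
  have fib: "card {p \<in> A \<times> B. (case p of (a, b) \<Rightarrow> a + b) = s} = card (A \<inter> B)" if s: "s \<in> subspace_sum A B" for s
  proof -
    obtain a b where ab: "a \<in> A" "b \<in> B" "s = a + b" using s by (auto simp: subspace_sum_def)
    have "bij_betw (\<lambda>c. (a + c, b - c)) (A \<inter> B) {p \<in> A \<times> B. (case p of (a, b) \<Rightarrow> a + b) = s}"
    proof (rule bij_betw_byWitness[where f' = "\<lambda>p. fst p - a"])
      show "(\<lambda>c. (a + c, b - c)) ` (A \<inter> B) \<subseteq> {p \<in> A \<times> B. (case p of (a, b) \<Rightarrow> a + b) = s}"
        using ab A B by (auto intro: fps.subspace_add fps.subspace_diff)
      show "(\<lambda>p. fst p - a) ` {p \<in> A \<times> B. (case p of (a, b) \<Rightarrow> a + b) = s} \<subseteq> A \<inter> B"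
      proof clarify
        fix a' b' assume *: "a' \<in> A" "b' \<in> B" "s = a' + b'"
        have "a' - a = b - b'" using ab(3) *(3) by (simp add: algebra_simps)
        then show "fst (a', b') - a \<in> A \<inter> B"
          using fps.subspace_diff[OF A *(1) ab(1)] fps.subspace_diff[OF B ab(2) *(2)] by simp
      qed
    qed (use ab in \<open>auto simp: algebra_simps\<close>)
    then show ?thesis by (simp add: bij_betw_same_card)
  qed
  have "card A * card B = card (A \<times> B)" by (simp add: card_cartesian_product)
  also have "\<dots> = (\<Sum>s\<in>subspace_sum A B. card {p \<in> A \<times> B. (case p of (a, b) \<Rightarrow> a + b) = s})"
    unfolding card_eq_sum subspace_sum_image using assms(1,2) by (intro sum.image_gen) simp
  also have "\<dots> = card (subspace_sum A B) * card (A \<inter> B)" using fib by simp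
  finally show ?thesis by simp
qed

text \<open>
  The dimension of the image of \<open>W\<close> in \<open>K[[t]] / t\<^sup>n K[[t]]\<close>, up to the constant factor \<open>ln |K|\<close>. The
  logarithm turns the product formula for cardinalities into the modular law.
\<close>

definition trunc_dim :: "nat \<Rightarrow> 'k::{field,finite} fps set \<Rightarrow> real" where
  "trunc_dim n W = ln (card (fps_cutoff n ` W))"

lemma trunc_dim_modular:
  assumes A: "tame A" and B: "tame B"
  shows "\<forall>\<^sub>F n in sequentially. trunc_dim n (subspace_sum A B) + trunc_dim n (A \<inter> B)
    = trunc_dim n A + trunc_dim n B"
  using tame_cutoff_inter[OF A B]
proof eventually_elim
  case (elim n)
  let ?A = "fps_cutoff n ` A" and ?B = "fps_cutoff n ` B"
  have fin: "finite (fps_cutoff n ` W)" for W :: "'a fps set"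
    using finite_range_cutoff by (rule finite_subset[rotated]) auto
  have sub: "fps.subspace A" "fps.subspace B" using A B by (simp_all add: tame_def)
  have sub': "fps.subspace ?A" "fps.subspace ?B"
    using sub linear_op_image_subspace[OF linear_op_cutoff] by auto
  have "fps_cutoff n ` subspace_sum A B = subspace_sum ?A ?B"
    by (force simp: subspace_sum_image fps_cutoff_add)
  then have "card (fps_cutoff n ` subspace_sum A B) * card (fps_cutoff n ` (A \<inter> B)) = card ?A * card ?B"
    using card_subspace_sum[OF fin fin sub'] elim by simp
  then have "real (card (fps_cutoff n ` subspace_sum A B)) * real (card (fps_cutoff n ` (A \<inter> B)))
      = real (card ?A) * real (card ?B)" by (metis of_nat_mult)
  moreover have pos: "0 < card (fps_cutoff n ` W)" if "0 \<in> W" for W :: "'a fps set"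
    using fin that by (auto simp: card_gt_0_iff)
  have "0 \<in> A" "0 \<in> B" "0 \<in> A \<inter> B" "0 \<in> subspace_sum A B"
    using sub subset_subspace_sum[OF sub] by (auto dest: fps.subspace_0)
  note this[THEN pos]
  ultimately show ?case
    unfolding trunc_dim_def by (metis ln_mult_pos of_nat_0_less_iff)
qed

text \<open>
  An element \<open>b\<close> of \<open>B\<close> outside \<open>A\<close> is separated from the closed set \<open>A\<close> by all late truncations.
\<close>

lemma trunc_dim_strict:
  assumes A: "tame A" and AB: "A \<subset> B"
  shows "\<forall>\<^sub>F n in sequentially. trunc_dim n A < trunc_dim n B"
proof -
  obtain b where b: "b \<in> B" "b \<notin> A" using AB by auto
  show ?thesis
    using tame_closed[OF A b(2)]
  proof eventually_elim
    case (elim n)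
    have "finite (fps_cutoff n ` B)"
      using finite_range_cutoff by (rule finite_subset[rotated]) auto
    moreover have "fps_cutoff n ` A \<subset> fps_cutoff n ` B" using AB b elim by auto
    ultimately have "card (fps_cutoff n ` A) < card (fps_cutoff n ` B)" by (rule psubset_card_mono)
    moreover have "A \<noteq> {}" using A fps.subspace_0 by (auto simp: tame_def)
    then have "0 < card (fps_cutoff n ` A)" using \<open>finite (fps_cutoff n ` B)\<close> AB
      by (meson card_gt_0_iff finite_subset image_is_empty image_mono psubset_imp_subset)
    ultimately show ?case by (simp add: trunc_dim_def)
  qed
qed

section \<open>Operators that eventually act as a Laurent series\<close>

definition acts_as :: "('k::field fps \<Rightarrow> 'k fps) \<Rightarrow> 'k fls \<Rightarrow> nat \<Rightarrow> bool" where
  "acts_as x a n \<longleftrightarrow> (\<forall>v\<in>tail n. fps_to_fls (x v) = a * fps_to_fls v)"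

definition laurent_op :: "('k::field fps \<Rightarrow> 'k fps) \<Rightarrow> bool" where
  "laurent_op x \<longleftrightarrow> linear_op x \<and> (\<exists>a n. acts_as x a n)"

lemma acts_as_mono: "acts_as x a m \<Longrightarrow> m \<le> n \<Longrightarrow> acts_as x a n"
  using tail_antimono by (auto simp: acts_as_def)

text \<open>
  The series \<open>b v\<close> must lie so far out that \<open>x\<close> acts on it as \<open>a\<close>; since \<open>b\<close> shifts the filtration
  by its subdegree, this determines the tail.
\<close>

lemma acts_as_comp:
  assumes x: "acts_as x a m" and y: "acts_as y b n"
  shows "acts_as (x \<circ> y) (a * b) (max n (nat (int m - fls_subdegree b)))"
  unfolding acts_as_def
proof
  fix v :: "'a fps" assume v: "v \<in> tail (max n (nat (int m - fls_subdegree b)))"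
  then have "fps_to_fls (y v) = b * fps_to_fls v"
    using y tail_antimono[of n "max n (nat (int m - fls_subdegree b))"] by (auto simp: acts_as_def)
  moreover from this have "y v \<in> tail m"
    using v by (intro laurent_times_tail[OF v]) auto
  ultimately show "fps_to_fls ((x \<circ> y) v) = a * b * fps_to_fls v"
    using x by (simp add: acts_as_def mult.assoc)
qed

lemma laurent_op_comp: "laurent_op x \<Longrightarrow> laurent_op y \<Longrightarrow> laurent_op (x \<circ> y)"
  unfolding laurent_op_def using acts_as_comp by (fastforce simp: linear_op_def)

lemma laurent_op_add:
  assumes "laurent_op x" "laurent_op y"
  shows "laurent_op (\<lambda>v. x v + y v)"
proof -
  obtain a b m n where "acts_as x a m" "acts_as y b n" using assms by (auto simp: laurent_op_def)
  then have "acts_as x a (max m n)" "acts_as y b (max m n)" using acts_as_mono by fastforce+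
  then have "acts_as (\<lambda>v. x v + y v) (a + b) (max m n)" by (simp add: acts_as_def distrib_right)
  then show ?thesis using assms by (auto simp: laurent_op_def linear_op_def algebra_simps)
qed

lemma laurent_op_uminus:
  assumes "laurent_op x"
  shows "laurent_op (\<lambda>v. - x v)"
proof -
  obtain a n where "acts_as x a n" using assms by (auto simp: laurent_op_def)
  then have "acts_as (\<lambda>v. - x v) (- a) n" by (simp add: acts_as_def)
  then show ?thesis using assms by (auto simp: laurent_op_def linear_op_def)
qed

lemma laurent_op_zero: "laurent_op (\<lambda>_. 0)"
proof -
  have "acts_as (\<lambda>_. 0) 0 0" by (simp add: acts_as_def)
  then show ?thesis by (auto simp: laurent_op_def linear_op_def)
qed

lemma laurent_op_id: "laurent_op id"
proof -
  have "acts_as id 1 0" by (simp add: acts_as_def)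
  then show ?thesis by (auto simp: laurent_op_def linear_op_def)
qed

lemma laurent_op_shift: "laurent_op (\<lambda>v. fps_X * v)"
proof -
  have "acts_as (\<lambda>v. fps_X * v) fls_X 0" by (simp add: acts_as_def fls_times_fps_to_fls)
  then show ?thesis by (auto simp: laurent_op_def linear_op_def algebra_simps)
qed

lemma laurent_op_unshift: "laurent_op (fps_shift 1)"
proof -
  have "acts_as (fps_shift 1) (inverse fls_X :: 'a fls) 1"
    unfolding acts_as_def
  proof
    fix v :: "'a fps" assume "v \<in> tail 1"
    then have "fps_X * fps_shift 1 v = v"
      by (auto simp: fps_eq_iff tail_def)
    then have "fps_to_fls v = fls_X * fps_to_fls (fps_shift 1 v)"
      by (metis fls_times_fps_to_fls fps_X_to_fls)
    then show "fps_to_fls (fps_shift 1 v) = inverse fls_X * fps_to_fls v"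
      by (simp add: mult.assoc[symmetric] del: fls_inverse_X)
  qed
  then show ?thesis by (auto simp: laurent_op_def linear_op_def fps_shift_add fps_eq_iff)
qed

text \<open>
  Far out in the filtration, multiplication by \<open>1/a\<close> yields power series on which \<open>x\<close> acts as \<open>a\<close>, so it
  is a section of \<open>x\<close> there.
\<close>

lemma acts_as_surj:
  fixes x :: "'k::field fps \<Rightarrow> 'k fps"
  assumes x: "acts_as x a n" and a: "a \<noteq> 0"
  obtains N where "\<And>w. w \<in> tail N \<Longrightarrow>
    \<exists>u. fps_to_fls u = inverse a * fps_to_fls w \<and> x u = w"
proof
  let ?N = "nat (int n + fls_subdegree a)"
  fix w :: "'k fps" assume w: "w \<in> tail ?N"
  have deg: "fls_subdegree (inverse a) = - fls_subdegree a" using a by simp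
  then have "0 \<le> int ?N + fls_subdegree (inverse a)" by linarith
  then obtain u where u: "fps_to_fls u = inverse a * fps_to_fls w"
    using laurent_times_tail_exists[OF w] by blast
  then have "u \<in> tail n" using deg by (intro laurent_times_tail[OF w]) auto
  then have "fps_to_fls (x u) = a * (inverse a * fps_to_fls w)" using x u by (simp add: acts_as_def)
  then have "x u = w" using a by (simp add: mult.assoc[symmetric])
  then show "\<exists>u. fps_to_fls u = inverse a * fps_to_fls w \<and> x u = w" using u by blast
qed

text \<open>
  An operator that kills a tail factors through a truncation.
\<close>

lemma acts_as_zero_finite_range:
  fixes x :: "'k::{field,finite} fps \<Rightarrow> 'k fps"
  assumes lin: "linear_op x" and x: "acts_as x 0 n"
  shows "finite (range x)"
proof -
  have "x v = x (fps_cutoff n v)" for v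
  proof -
    have "v - fps_cutoff n v \<in> tail n" by (simp add: tail_def)
    then have "x (v - fps_cutoff n v) = 0" using x by (simp add: acts_as_def)
    moreover have "x v = x ((v - fps_cutoff n v) + fps_cutoff n v)" by simp
    ultimately show ?thesis using lin unfolding linear_op_def by (metis add_0)
  qed
  then have "range x \<subseteq> x ` range (fps_cutoff n)" by blast
  then show ?thesis using finite_range_cutoff by (meson finite_imageI finite_subset)
qed

lemma tame_range:
  fixes x :: "'k::{field,finite} fps \<Rightarrow> 'k fps"
  assumes "laurent_op x"
  shows "tame (range x)"
proof -
  obtain a n where lin: "linear_op x" and x: "acts_as x a n" using assms by (auto simp: laurent_op_def)
  have "fps.subspace (range x)" using linear_op_image_subspace[OF lin fps.subspace_UNIV] .
  moreover have "finite (range x) \<or> (\<exists>m. tail m \<subseteq> range x)"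
  proof (cases "a = 0")
    case True
    then show ?thesis using acts_as_zero_finite_range[OF lin] x by simp
  next
    case False
    then show ?thesis using acts_as_surj[OF x] by (metis rangeI subsetI)
  qed
  ultimately show ?thesis by (simp add: tame_def)
qed

text \<open>
  A linear projection onto a finite subspace \<open>W\<close> need not kill a tail. One that does is obtained from a
  truncation that is injective on \<open>W\<close>, followed by a linear left inverse.
\<close>

lemma finite_projection:
  fixes W :: "'k::field fps set"
  assumes "fps.subspace W" and "finite W"
  obtains q n where "linear_op q" "range q \<subseteq> W" "\<And>w. w \<in> W \<Longrightarrow> q w = w" "acts_as q 0 n"
proof -
  obtain m where m: "W \<inter> tail m \<subseteq> {0}" using finite_inter_tail[OF assms(2)] .
  have "inj_on (fps_cutoff m) W"
  proof (rule inj_onI)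
    fix u v assume "u \<in> W" "v \<in> W" "fps_cutoff m u = fps_cutoff m v"
    then have "u - v \<in> W \<inter> tail m"
      using fps.subspace_diff[OF assms(1)] by (simp add: cutoff_eq_iff)
    with m show "u = v" by auto
  qed
  then obtain g where g: "linear_op g" "range g \<subseteq> W" "\<And>w. w \<in> W \<Longrightarrow> g (fps_cutoff m w) = w"
    using linear_op_left_inverse[OF linear_op_cutoff assms(1)] by blast
  have "acts_as (g \<circ> fps_cutoff m) 0 m"
    using linear_op_zero[OF g(1)] by (simp add: acts_as_def flip: cutoff_zero_iff)
  moreover have "linear_op (g \<circ> fps_cutoff m)"
    using g(1) linear_op_cutoff by (rule linear_op_comp)
  ultimately show thesis using g by (intro that[of "g \<circ> fps_cutoff m" m]) auto
qed

lemma subspace_projection: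
  fixes W :: "'k::field fps set"
  assumes "fps.subspace W"
  obtains q where "linear_op q" "range q \<subseteq> W" "\<And>w. w \<in> W \<Longrightarrow> q w = w"
proof -
  have "linear_op id" by (simp add: linear_op_def)
  from linear_op_left_inverse[OF this assms inj_on_id] that show thesis by auto
qed

text \<open>
  A projection onto \<open>W\<close> is in the ring: if \<open>W\<close> is finite, it can be chosen to act as 0 far out, and if \<open>W\<close>
  contains a tail, it acts as 1 there.
\<close>

lemma tame_is_range:
  assumes "tame W"
  obtains q where "laurent_op q" "range q = W"
proof (cases "finite W")
  case True
  then obtain q n where "linear_op q" "range q \<subseteq> W" "\<And>w. w \<in> W \<Longrightarrow> q w = w" "acts_as q 0 n"
    using finite_projection assms by (metis tame_def)
  then show thesis by (intro that[of q]) (auto simp: laurent_op_def, metis rangeI)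
next
  case False
  then obtain m where m: "fps.subspace W" "tail m \<subseteq> W" using assms by (auto simp: tame_def)
  obtain q where q: "linear_op q" "range q \<subseteq> W" "\<And>w. w \<in> W \<Longrightarrow> q w = w"
    using subspace_projection[OF m(1)] by blast
  then have "acts_as q 1 m" using m(2) by (auto simp: acts_as_def)
  with q show thesis by (intro that[of q]) (auto simp: laurent_op_def, metis rangeI)
qed

text \<open>
  A quasi-inverse is any operator \<open>y\<close> in the ring that is a section of \<open>x\<close> on the range of \<open>x\<close>. A linear
  section \<open>g\<close> exists by linear algebra but need not act as a Laurent series far out, so it is
  corrected there. If \<open>x\<close> has finite range, precede \<open>g\<close> by a projection onto the range that kills a tail. If
  \<open>x\<close> acts as \<open>a \<noteq> 0\<close>, split off a tail in the range of \<open>x\<close> by a projection \<open>q\<close>, and use the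
  section \<open>1/a\<close> on that tail and \<open>g\<close> on the rest.
\<close>

lemma laurent_op_regular:
  fixes x :: "'k::{field,finite} fps \<Rightarrow> 'k fps"
  assumes "laurent_op x"
  obtains y where "laurent_op y" "x \<circ> y \<circ> x = x"
proof -
  obtain a n where lin: "linear_op x" and x: "acts_as x a n" using assms by (auto simp: laurent_op_def)
  obtain g where g: "linear_op g" "\<And>v. v \<in> range x \<Longrightarrow> x (g v) = v"
    using linear_op_section[OF lin] by blast
  have "\<exists>y. laurent_op y \<and> (\<forall>v\<in>range x. x (y v) = v)"
  proof (cases "a = 0")
    case True
    have "fps.subspace (range x)" using linear_op_image_subspace[OF lin fps.subspace_UNIV] .
    then obtain q m where q: "linear_op q" "\<And>w. w \<in> range x \<Longrightarrow> q w = w" "acts_as q 0 m"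
      using acts_as_zero_finite_range[OF lin x[unfolded True]] finite_projection by metis
    have "g 0 = 0" using g(1) by (rule linear_op_zero)
    then have "acts_as (g \<circ> q) 0 m" using q(3) by (simp add: acts_as_def)
    then have "laurent_op (g \<circ> q)" using g(1) q(1) by (auto simp: laurent_op_def linear_op_def)
    then show ?thesis using g(2) q(2) by (intro exI[of _ "g \<circ> q"]) simp
  next
    case False
    obtain N where N: "\<And>w. w \<in> tail N \<Longrightarrow> \<exists>u. fps_to_fls u = inverse a * fps_to_fls w \<and> x u = w"
      using acts_as_surj[OF x False] by blast
    \<comment> \<open>The regular part extends division by \<open>a\<close> on the tail to a linear operator on all series.\<close>
    define s where "s w = fls_regpart (inverse a * fps_to_fls w)" for w
    have s: "fps_to_fls (s w) = inverse a * fps_to_fls w" "x (s w) = w" if w: "w \<in> tail N" for w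
      using N[OF w] by (auto simp: s_def) (metis fls_regpart_fps_trivial)+
    have lin_s: "linear_op s"
    proof -
      have "fls_regpart (inverse a * (fls_const c * F)) = fps_const c * fls_regpart (inverse a * F)"
        for c and F :: "'k fls"
        by (simp add: fps_eq_iff mult.left_commute[of "inverse a"])
      then show ?thesis
        by (simp add: linear_op_def s_def fls_times_fps_to_fls distrib_left)
    qed
    obtain q :: "'k fps \<Rightarrow> 'k fps" where q: "linear_op q" "range q \<subseteq> tail N" "\<And>w. w \<in> tail N \<Longrightarrow> q w = w"
      using subspace_projection[OF tail_subspace] by blast
    define y where "y v = s (q v) + g (v - q v)" for v
    have "linear_op y"
    proof -
      have "fps_const c * v - q (fps_const c * v) = fps_const c * (v - q v)" for c v
        using q(1) by (simp add: linear_op_def algebra_simps)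
      then show ?thesis
        using lin_s g(1) q(1) by (simp add: linear_op_def y_def distrib_left add_diff_add)
    qed
    moreover have "acts_as y (inverse a) N"
      unfolding acts_as_def
    proof
      fix v :: "'k fps" assume v: "v \<in> tail N"
      have "g 0 = 0" using g(1) by (rule linear_op_zero)
      then have "y v = s v" using q(3)[OF v] by (simp add: y_def)
      then show "fps_to_fls (y v) = inverse a * fps_to_fls v" using s(1)[OF v] by simp
    qed
    moreover have "x (y v) = v" if v: "v \<in> range x" for v
    proof -
      have xs: "x (s (q v)) = q v" using q(2) by (intro s(2)) auto
      then have "q v \<in> range x" by (metis rangeI)
      then have "v - q v \<in> range x"
        using v fps.subspace_diff[OF linear_op_image_subspace[OF lin fps.subspace_UNIV]] by blast
      then have "x (g (v - q v)) = v - q v" by (rule g(2))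
      then show ?thesis using xs lin by (simp add: y_def linear_op_def)
    qed
    ultimately show ?thesis by (auto simp: laurent_op_def)
  qed
  then show thesis using that by (force simp: fun_eq_iff)
qed

section \<open>The ring of these operators and its lattice of right ideals\<close>

text \<open>
  An isomorphic copy \<open>R\<close> of the ring of operators, with isomorphism \<open>rep\<close>. The elements are kept
  abstract so that the ring can be placed in a prescribed type.
\<close>

locale laurent_op_ring =
  fixes R :: "('r, 'm) ring_scheme" (structure) and rep :: "'r \<Rightarrow> 'k::{field,finite} fps \<Rightarrow> 'k fps"
  assumes bij_rep: "bij_betw rep (carrier R) {x. laurent_op x}"
    and mult_rep: "\<lbrakk>x \<in> carrier R; y \<in> carrier R\<rbrakk> \<Longrightarrow>
      x \<otimes> y \<in> carrier R \<and> rep (x \<otimes> y) = rep x \<circ> rep y"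
    and add_rep: "\<lbrakk>x \<in> carrier R; y \<in> carrier R\<rbrakk> \<Longrightarrow>
      x \<oplus> y \<in> carrier R \<and> rep (x \<oplus> y) = (\<lambda>v. rep x v + rep y v)"
    and one_rep: "\<one> \<in> carrier R \<and> rep \<one> = id"
    and zero_rep: "\<zero> \<in> carrier R \<and> rep \<zero> = (\<lambda>_. 0)"
begin

lemma laurent_op_rep: "x \<in> carrier R \<Longrightarrow> laurent_op (rep x)"
  using bij_rep by (auto simp: bij_betw_def)

lemma rep_eqI: "\<lbrakk>x \<in> carrier R; y \<in> carrier R; rep x = rep y\<rbrakk> \<Longrightarrow> x = y"
  using bij_rep by (auto simp: bij_betw_def inj_on_def)

lemma rep_surj:
  assumes "laurent_op f"
  obtains x where "x \<in> carrier R" "rep x = f"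
proof -
  have "f \<in> rep ` carrier R" using assms bij_rep by (simp add: bij_betw_def)
  then show thesis using that by auto
qed

lemma linear_rep: "x \<in> carrier R \<Longrightarrow> rep x (u + v) = rep x u + rep x v"
  using laurent_op_rep by (simp add: laurent_op_def linear_op_def)

lemma is_regular_ring: "regular_ring R"
proof -
  have add_inverse: "\<exists>y\<in>carrier R. y \<oplus> x = \<zero>" if x: "x \<in> carrier R" for x
  proof -
    obtain y where y: "y \<in> carrier R" "rep y = (\<lambda>v. - rep x v)"
      using rep_surj[OF laurent_op_uminus[OF laurent_op_rep[OF x]]] .
    then have "y \<oplus> x = \<zero>" using x by (intro rep_eqI) (simp_all add: add_rep zero_rep)
    with y show ?thesis by blast
  qed
  have "ring R"
  proof (rule ringI)
    show "abelian_group R"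
      by (rule abelian_groupI)
        (auto intro: rep_eqI add_inverse simp: add_rep zero_rep add_ac)
    show "Group.monoid R"
      by (rule monoidI) (auto intro: rep_eqI simp: mult_rep one_rep comp_assoc)
  qed (auto intro!: rep_eqI simp: add_rep mult_rep linear_rep)
  moreover have "\<exists>y\<in>carrier R. x \<otimes> y \<otimes> x = x" if x: "x \<in> carrier R" for x
  proof -
    obtain f where f: "laurent_op f" "rep x \<circ> f \<circ> rep x = rep x"
      using laurent_op_regular[OF laurent_op_rep[OF x]] .
    obtain y where y: "y \<in> carrier R" "rep y = f" using rep_surj[OF f(1)] .
    then have "x \<otimes> y \<otimes> x = x" using x f by (intro rep_eqI) (simp_all add: mult_rep)
    with y show ?thesis by blast
  qed
  ultimately show ?thesis by (simp add: regular_ring_def regular_ring_axioms_def)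
qed

sublocale regular_ring R by (rule is_regular_ring)

text \<open>
  Multiplication by \<open>t\<close> is injective, but its range omits the series 1.
\<close>

lemma shift_one_sided_inverse:
  obtains x y where "x \<in> carrier R" "y \<in> carrier R" "y \<otimes> x = \<one>" "x \<otimes> y \<noteq> \<one>"
proof -
  obtain x where x: "x \<in> carrier R" "rep x = (\<lambda>v. fps_X * v)" using rep_surj[OF laurent_op_shift] .
  obtain y where y: "y \<in> carrier R" "rep y = fps_shift 1" using rep_surj[OF laurent_op_unshift] .
  have "rep (y \<otimes> x) = id" using x y by (simp add: mult_rep fun_eq_iff fps_eq_iff)
  then have "y \<otimes> x = \<one>" using x y by (intro rep_eqI) (simp_all add: one_rep)
  moreover have "x \<otimes> y \<noteq> \<one>"
  proof
    assume "x \<otimes> y = \<one>"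
    then have "rep x \<circ> rep y = id" using mult_rep[of x y] x(1) y(1) one_rep by simp
    then have "rep x (rep y 1) = 1" by (simp add: fun_eq_iff)
    then have "(rep x (rep y 1)) $ 0 = 1" by simp
    then show False using x(2) by simp
  qed
  ultimately show thesis using that x y by blast
qed

text \<open>
  For a principal right ideal this is the range of any generator. The union makes the value depend on
  the ideal alone.
\<close>

definition ideal_range :: "'r set \<Rightarrow> 'k fps set" where
  "ideal_range I = (\<Union>x\<in>I. range (rep x))"

lemma ideal_range_principal:
  assumes x: "x \<in> carrier R"
  shows "ideal_range (principal_right_ideal R x) = range (rep x)"
proof
  show "ideal_range (principal_right_ideal R x) \<subseteq> range (rep x)"
    using x by (auto simp: ideal_range_def principal_right_ideal_def mult_rep)
  have "x = x \<otimes> \<one>" using x by simp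
  then have "x \<in> principal_right_ideal R x" unfolding principal_right_ideal_def by blast
  then show "range (rep x) \<subseteq> ideal_range (principal_right_ideal R x)" by (auto simp: ideal_range_def)
qed

text \<open>
  If \<open>y z y = y\<close>, then \<open>y z\<close> is the identity on the range of \<open>y\<close>. So if the range of \<open>x\<close> is contained in it,
  then \<open>x = y z x\<close>, which lies in \<open>y R\<close>.
\<close>

lemma principal_subset_iff_range:
  assumes x: "x \<in> carrier R" and y: "y \<in> carrier R"
  shows "principal_right_ideal R x \<subseteq> principal_right_ideal R y \<longleftrightarrow> range (rep x) \<subseteq> range (rep y)"
proof
  assume "principal_right_ideal R x \<subseteq> principal_right_ideal R y"
  then have "ideal_range (principal_right_ideal R x) \<subseteq> ideal_range (principal_right_ideal R y)"
    by (auto simp: ideal_range_def)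
  then show "range (rep x) \<subseteq> range (rep y)" using x y by (simp add: ideal_range_principal)
next
  assume sub: "range (rep x) \<subseteq> range (rep y)"
  obtain z where z: "z \<in> carrier R" "y \<otimes> z \<otimes> y = y" using regular[OF y] by blast
  have "rep y (rep z (rep x v)) = rep x v" for v
  proof -
    obtain u where "rep x v = rep y u" using sub by blast
    moreover have "rep y (rep z (rep y u)) = rep (y \<otimes> z \<otimes> y) u" using y z(1) by (simp add: mult_rep)
    ultimately show ?thesis using z(2) by simp
  qed
  then have yzx: "y \<otimes> (z \<otimes> x) = x"
    using x y z(1) by (intro rep_eqI) (simp_all add: mult_rep fun_eq_iff)
  show "principal_right_ideal R x \<subseteq> principal_right_ideal R y"
  proof
    fix s assume "s \<in> principal_right_ideal R x"
    then obtain r where r: "r \<in> carrier R" "s = x \<otimes> r" by (auto simp: principal_right_ideal_def)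
    then have "s = y \<otimes> (z \<otimes> x \<otimes> r)" using x y z(1) yzx by (metis m_assoc m_closed)
    then show "s \<in> principal_right_ideal R y"
      using r x z(1) unfolding principal_right_ideal_def by blast
  qed
qed

abbreviation L :: "'r set gorder" where
  "L \<equiv> right_ideal_lattice R"

lemma tame_ideal_range: "I \<in> carrier L \<Longrightarrow> tame (ideal_range I)"
  by (auto simp: right_ideal_lattice_def ideal_range_principal tame_range laurent_op_rep)

lemma le_iff_range:
  "\<lbrakk>I \<in> carrier L; J \<in> carrier L\<rbrakk> \<Longrightarrow> I \<sqsubseteq>\<^bsub>L\<^esub> J \<longleftrightarrow> ideal_range I \<subseteq> ideal_range J"
proof -
  assume "I \<in> carrier L" "J \<in> carrier L"
  then obtain x y where "x \<in> carrier R" "y \<in> carrier R"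
    "I = principal_right_ideal R x" "J = principal_right_ideal R y"
    by (auto simp: right_ideal_lattice_def)
  moreover have "I \<sqsubseteq>\<^bsub>L\<^esub> J \<longleftrightarrow> I \<subseteq> J" by (simp add: right_ideal_lattice_def)
  ultimately show "I \<sqsubseteq>\<^bsub>L\<^esub> J \<longleftrightarrow> ideal_range I \<subseteq> ideal_range J"
    by (simp only: ideal_range_principal principal_subset_iff_range)
qed

lemma tame_is_ideal_range:
  assumes "tame W"
  obtains I where "I \<in> carrier L" "ideal_range I = W"
proof -
  obtain q where q: "laurent_op q" "range q = W" using tame_is_range[OF assms] .
  obtain x where "x \<in> carrier R" "rep x = q" using rep_surj[OF q(1)] .
  then show thesis using q(2)
    by (intro that[of "principal_right_ideal R x"])
      (auto simp: right_ideal_lattice_def ideal_range_principal)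
qed

lemma lattice_partial_order: "partial_order L"
  by unfold_locales (auto simp: right_ideal_lattice_def)

text \<open>
  The order isomorphism onto the tame subspaces carries joins and meets to sums and intersections, because
  tame subspaces are closed under these operations.
\<close>

lemma ideal_range_join:
  assumes I: "I \<in> carrier L" and J: "J \<in> carrier L"
  shows "ideal_range (I \<squnion>\<^bsub>L\<^esub> J) = subspace_sum (ideal_range I) (ideal_range J)"
proof -
  interpret partial_order L by (rule lattice_partial_order)
  have sub: "fps.subspace (ideal_range I)" "fps.subspace (ideal_range J)"
    using tame_ideal_range I J by (simp_all add: tame_def)
  obtain K where K: "K \<in> carrier L" "ideal_range K = subspace_sum (ideal_range I) (ideal_range J)"
    using tame_is_ideal_range[OF tame_sum[OF tame_ideal_range[OF I] tame_ideal_range[OF J]]] .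
  have "least L K (Upper L {I, J})"
  proof (rule least_UpperI)
    have "I \<sqsubseteq>\<^bsub>L\<^esub> K" "J \<sqsubseteq>\<^bsub>L\<^esub> K"
      using subset_subspace_sum[OF sub] I J K by (simp_all add: le_iff_range)
    then show "M \<sqsubseteq>\<^bsub>L\<^esub> K" if "M \<in> {I, J}" for M using that by blast
  next
    fix M assume M: "M \<in> Upper L {I, J}"
    then have M': "M \<in> carrier L" "I \<sqsubseteq>\<^bsub>L\<^esub> M" "J \<sqsubseteq>\<^bsub>L\<^esub> M" using I J by (auto simp: Upper_def)
    then have "ideal_range I \<subseteq> ideal_range M" "ideal_range J \<subseteq> ideal_range M"
      using I J by (simp_all add: le_iff_range)
    moreover have "fps.subspace (ideal_range M)"
      using tame_ideal_range[OF M'(1)] by (simp add: tame_def)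
    ultimately have "ideal_range K \<subseteq> ideal_range M"
      unfolding K(2) subspace_sum_def by (blast intro: fps.subspace_add)
    then show "K \<sqsubseteq>\<^bsub>L\<^esub> M" using K(1) M'(1) by (simp add: le_iff_range)
  qed (use I J K in auto)
  then have "I \<squnion>\<^bsub>L\<^esub> J = K"
    unfolding join_def sup_def by (rule some_equality) (erule least_unique, fact)
  then show ?thesis using K by simp
qed

lemma ideal_range_meet:
  assumes I: "I \<in> carrier L" and J: "J \<in> carrier L"
  shows "ideal_range (I \<sqinter>\<^bsub>L\<^esub> J) = ideal_range I \<inter> ideal_range J"
proof -
  interpret partial_order L by (rule lattice_partial_order)
  obtain K where K: "K \<in> carrier L" "ideal_range K = ideal_range I \<inter> ideal_range J"
    using tame_is_ideal_range[OF tame_inter[OF tame_ideal_range[OF I] tame_ideal_range[OF J]]] .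
  have "greatest L K (Lower L {I, J})"
  proof (rule greatest_LowerI)
    have "K \<sqsubseteq>\<^bsub>L\<^esub> I" "K \<sqsubseteq>\<^bsub>L\<^esub> J" using I J K by (simp_all add: le_iff_range)
    then show "K \<sqsubseteq>\<^bsub>L\<^esub> M" if "M \<in> {I, J}" for M using that by blast
  next
    fix M assume M: "M \<in> Lower L {I, J}"
    then have "M \<in> carrier L" "M \<sqsubseteq>\<^bsub>L\<^esub> I" "M \<sqsubseteq>\<^bsub>L\<^esub> J" using I J by (auto simp: Lower_def)
    then show "M \<sqsubseteq>\<^bsub>L\<^esub> K" using I J K by (simp add: le_iff_range)
  qed (use I J K in auto)
  then have "I \<sqinter>\<^bsub>L\<^esub> J = K"
    unfolding meet_def inf_def by (rule some_equality) (erule greatest_unique, fact)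
  then show ?thesis using K by simp
qed

theorem Dim_not_iso_V: "\<not> (Dim L \<cong> V_monoid R)"
proof -
  obtain x y where "x \<in> carrier R" "y \<in> carrier R" "y \<otimes> x = \<one>" "x \<otimes> y \<noteq> \<one>"
    using shift_one_sided_inverse .
  then obtain p q z where pqz: "p \<in> carrier (V_monoid R)" "q \<in> carrier (V_monoid R)"
    "z \<in> carrier (V_monoid R)" "p \<otimes>\<^bsub>V_monoid R\<^esub> q = p" "q \<otimes>\<^bsub>V_monoid R\<^esub> z \<noteq> z"
    by (rule V_monoid_absorption)
  show ?thesis
  proof (rule Dim_not_iso[OF _ _ pqz, where d = "\<lambda>n I. trunc_dim n (ideal_range I)"])
    fix I J assume "I \<in> carrier L" "J \<in> carrier L"
    then show "\<forall>\<^sub>F n in sequentially.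
        trunc_dim n (ideal_range (I \<squnion>\<^bsub>L\<^esub> J)) + trunc_dim n (ideal_range (I \<sqinter>\<^bsub>L\<^esub> J))
        = trunc_dim n (ideal_range I) + trunc_dim n (ideal_range J)"
      by (simp add: ideal_range_join ideal_range_meet trunc_dim_modular tame_ideal_range)
  next
    fix I J assume "(I, J) \<in> intervals L" and neq: "I \<noteq> J"
    then have IJ: "I \<in> carrier L" "J \<in> carrier L" "I \<sqsubseteq>\<^bsub>L\<^esub> J" by (auto simp: intervals_def)
    then have "\<not> J \<sqsubseteq>\<^bsub>L\<^esub> I" using neq by (auto simp: right_ideal_lattice_def)
    then have "ideal_range I \<subset> ideal_range J" using IJ by (auto simp: le_iff_range)
    then show "\<forall>\<^sub>F n in sequentially. trunc_dim n (ideal_range I) < trunc_dim n (ideal_range J)"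
      by (rule trunc_dim_strict[OF tame_ideal_range[OF IJ(1)]])
  qed
qed

end

section \<open>Coding the operators over the two-element field by sets of sets of numbers\<close>

instance bit :: finite
proof
  have "x \<in> {0, 1}" for x :: bit by (cases x) simp_all
  then have "UNIV \<subseteq> {0, 1 :: bit}" by (rule subsetI)
  then show "finite (UNIV :: bit set)" by (rule finite_subset) simp
qed

definition series_code :: "bit fps \<Rightarrow> nat set" where
  "series_code v = {n. v $ n = 1}"

text \<open>
  The graph of the relation \<open>x v $ n = 1\<close> between series \<open>v\<close> and numbers \<open>n\<close>. A pair \<open>(v, n)\<close> is coded as a set of
  numbers with the coefficients of \<open>v\<close> at the odd positions and \<open>n\<close> marked at an even position.
\<close>

definition op_code :: "(bit fps \<Rightarrow> bit fps) \<Rightarrow> nat set set" where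
  "op_code x = {insert (2 * n) ((\<lambda>i. 2 * i + 1) ` series_code v) | v n. x v $ n = 1}"

lemma inj_series_code: "series_code u = series_code v \<Longrightarrow> u = v"
proof -
  assume "series_code u = series_code v"
  then have "u $ n = 1 \<longleftrightarrow> v $ n = 1" for n by (auto simp: series_code_def set_eq_iff)
  then have "u $ n = v $ n" for n by (cases "u $ n"; cases "v $ n") (metis zero_neq_one)+
  then show "u = v" by (simp add: fps_eq_iff)
qed

lemma inj_op_code: "inj op_code"
proof (rule injI)
  fix x y assume eq: "op_code x = op_code y"
  have code: "insert (2 * n) ((\<lambda>i. 2 * i + 1) ` series_code v) \<in> op_code x \<longleftrightarrow> x v $ n = 1" for x v n
  proof
    assume "insert (2 * n) ((\<lambda>i. 2 * i + 1) ` series_code v) \<in> op_code x"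
    then obtain u m where um: "x u $ m = 1"
      "insert (2 * n) ((\<lambda>i. 2 * i + 1) ` series_code v) = insert (2 * m) ((\<lambda>i. 2 * i + 1) ` series_code u)"
      (is "?A = ?B")
      by (auto simp: op_code_def)
    have "{i. 2 * i \<in> ?A} = {i. 2 * i \<in> ?B}" "{i. 2 * i + 1 \<in> ?A} = {i. 2 * i + 1 \<in> ?B}"
      using um(2) by simp_all
    moreover have parity: "2 * i + 1 \<noteq> 2 * j" "2 * j \<noteq> 2 * i + 1" for i j :: nat by presburger+
    have "{i. 2 * i \<in> insert (2 * m) ((\<lambda>i. 2 * i + 1) ` S)} = {m}"
      "{i. 2 * i + 1 \<in> insert (2 * m) ((\<lambda>i. 2 * i + 1) ` S)} = S" for m and S :: "nat set"
      using parity by (auto simp del: One_nat_def)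
    ultimately have "n = m" "series_code v = series_code u" by simp_all
    then show "x v $ n = 1" using um(1) inj_series_code by blast
  qed (auto simp: op_code_def)
  have "x v $ n = 1 \<longleftrightarrow> y v $ n = 1" for v n using code eq by metis
  then have "series_code (x v) = series_code (y v)" for v by (simp add: series_code_def)
  then show "x = y" by (simp add: fun_eq_iff inj_series_code)
qed

definition op_decode :: "nat set set \<Rightarrow> bit fps \<Rightarrow> bit fps" where
  "op_decode = inv_into UNIV op_code"

lemma op_decode_code [simp]: "op_decode (op_code x) = x"
  by (simp add: op_decode_def inj_op_code)

definition coded_laurent_ops :: "nat set set ring" where
  "coded_laurent_ops =
     \<lparr>carrier = op_code ` {x. laurent_op x},
      monoid.mult = (\<lambda>a b. op_code (op_decode a \<circ> op_decode b)),
      one = op_code id,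
      zero = op_code (\<lambda>_. 0),
      add = (\<lambda>a b. op_code (\<lambda>v. op_decode a v + op_decode b v))\<rparr>"

interpretation coded_laurent_ops: laurent_op_ring coded_laurent_ops op_decode
proof
  show "bij_betw op_decode (carrier coded_laurent_ops) {x. laurent_op x}"
    by (rule bij_betw_byWitness[where f' = op_code]) (auto simp: coded_laurent_ops_def)
qed (auto simp: coded_laurent_ops_def laurent_op_comp laurent_op_add laurent_op_id laurent_op_zero)

theorem corollary11p18:
  shows "\<exists>R :: nat set set ring.
           regular_ring R \<and> \<not> (Dim (right_ideal_lattice R) \<cong> V_monoid R)"
  using coded_laurent_ops.is_regular_ring coded_laurent_ops.Dim_not_iso_V by blast

end
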